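(* Let $n\ge2$, $m\ge2$ be integers with $m\ge\sqrt n$, let $B_1,\ldots,B_m$ be mutually unbiased orthonormal bases of $\mathbb{C}^n$, and let $\mathfrak{B}=\bigsqcup_{i=1}^m B_i$. Let $p$ be a positive integer with $y=\frac pn\in(0,1)$. Let $\Omega_p$ be the set of all maps $s:\{1,\ldots,p\}\to\mathfrak{B}$ with the uniform probability, and for $s\in\Omega_p$ let $\mathcal{G}(s)$ be the $p\times p$ matrix with $(i,j)$-entry $\langle s(i),s(j)\rangle$. For a positive integer $l$ set $A_l(s)=\frac1p\mathrm{Tr}\big(\mathcal{G}(s)^l\big)$. Then for every fixed positive integer $l$, $$\mathbb{E}\big(A_l(s),\Omega_p\big)=\sum_{i=0}^{l-1}\frac{y^i}{i+1}\binom{l}{i}\binom{l-1}{i}+O_l\!\left(\frac1m+\frac1n\right),$$ where the implied constant depends only on $l$.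
   Context: Orthonormal bases $B_1,\ldots,B_m$ of $\mathbb{C}^n$ are mutually unbiased if $|\langle u,v\rangle|=\frac{1}{\sqrt n}$ for all $u\in B_i$, $v\in B_j$, $i\ne j$, where $\langle\cdot,\cdot\rangle$ is the standard Hermitian inner product. $\mathbb{E}(\cdot,\Omega_p)$ denotes expectation with respect to the uniform probability on $\Omega_p$ (equivalently, $s(1),\ldots,s(p)$ are chosen uniformly and independently from the $mn$ vectors of $\mathfrak{B}$). *)

theory Defs
  imports "HOL-Analysis.Analysis" "Jordan_Normal_Form.Matrix"
begin

text \<open>Vectors of C^n are represented as functions nat => complex; only the
  coordinates 0..n-1 matter.  Standard Hermitian inner product.\<close>
definition cinner :: "nat \<Rightarrow> (nat \<Rightarrow> complex) \<Rightarrow> (nat \<Rightarrow> complex) \<Rightarrow> complex" where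
  "cinner n u v = (\<Sum>k<n. u k * cnj (v k))"

definition orthonormal_basis :: "nat \<Rightarrow> (nat \<Rightarrow> nat \<Rightarrow> complex) \<Rightarrow> bool" where
  "orthonormal_basis n b \<longleftrightarrow>
     (\<forall>k<n. \<forall>k'<n. cinner n (b k) (b k') = (if k = k' then 1 else 0))"

definition mutually_unbiased :: "nat \<Rightarrow> nat \<Rightarrow> (nat \<Rightarrow> nat \<Rightarrow> nat \<Rightarrow> complex) \<Rightarrow> bool" where
  "mutually_unbiased n m B \<longleftrightarrow>
     (\<forall>i<m. orthonormal_basis n (B i)) \<and>
     (\<forall>i<m. \<forall>j<m. i \<noteq> j \<longrightarrow>
        (\<forall>k<n. \<forall>k'<n. cmod (cinner n (B i k) (B j k')) = 1 / sqrt (real n)))"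

text \<open>The disjoint union of the bases is indexed by pairs (i,k), i<m, k<n.
  Omega_p = all maps {0..p-1} -> that index set.\<close>
definition Omega :: "nat \<Rightarrow> nat \<Rightarrow> nat \<Rightarrow> (nat \<Rightarrow> nat \<times> nat) set" where
  "Omega m n p = PiE {..<p} (\<lambda>_. {..<m} \<times> {..<n})"

definition gram :: "nat \<Rightarrow> (nat \<Rightarrow> nat \<Rightarrow> nat \<Rightarrow> complex) \<Rightarrow> nat \<Rightarrow> (nat \<Rightarrow> nat \<times> nat) \<Rightarrow> complex mat" where
  "gram n B p s = mat p p (\<lambda>(a, b).
      cinner n (B (fst (s a)) (snd (s a))) (B (fst (s b)) (snd (s b))))"

definition mat_trace :: "complex mat \<Rightarrow> complex" where
  "mat_trace A = (\<Sum>i<dim_row A. A $$ (i, i))"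

definition A_l :: "nat \<Rightarrow> nat \<Rightarrow> (nat \<Rightarrow> nat \<Rightarrow> nat \<Rightarrow> complex) \<Rightarrow> nat \<Rightarrow> (nat \<Rightarrow> nat \<times> nat) \<Rightarrow> complex" where
  "A_l l n B p s = mat_trace (gram n B p s ^\<^sub>m l) / of_nat p"

definition expect_A :: "nat \<Rightarrow> nat \<Rightarrow> nat \<Rightarrow> (nat \<Rightarrow> nat \<Rightarrow> nat \<Rightarrow> complex) \<Rightarrow> nat \<Rightarrow> complex" where
  "expect_A l m n B p = (\<Sum>s\<in>Omega m n p. A_l l n B p s) / of_nat (card (Omega m n p))"

end

theory Submission
  imports Defs "HOL-Library.Sublist" "Jordan_Normal_Form.Determinant"
begin

text \<open>
  Expanding the trace, the expectation of \<open>A\<^sub>l\<close> is a sum over words \<open>w\<close> of length \<open>l\<close> in \<open>p\<close> letters,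
  a word with \<open>k\<close> letters contributing \<open>n/p \<cdot> n\<^sup>-\<^sup>k \<cdot> G(w)\<close>, where \<open>G(w)\<close> is the normalised sum of the
  cyclic products of Gram kernel entries. The vectors have norm one, so a letter repeated
  cyclically next to itself can be deleted; they form a tight frame, so a letter that occurs once
  can be summed out. Neither step changes \<open>G(w)\<close>, and a noncrossing word reduces to a single letter,
  where \<open>G = 1\<close>. A word allowing neither step is crossing and has every letter at least twice, so the
  unbiasedness bound \<open>n\<^sup>-\<^sup>1\<^sup>/\<^sup>2\<close> on the off-diagonal entries makes the injective part of \<open>G\<close> at most
  \<open>1/n\<close>, while identifying two letters costs a factor \<open>1/m\<close>. Hence only noncrossing words survive.
  These are counted by reading a word from the right and keeping the stack of letters that may still
  be prepended; the number of words with given stack height and number of letters has a closed form,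
  and summing over the height gives the Narayana numbers.
\<close>

section \<open>Noncrossing words\<close>

definition crossing :: "'a list \<Rightarrow> bool" where
  "crossing w \<longleftrightarrow> (\<exists>a b. a \<noteq> b \<and> subseq [a, b, a, b] w)"

lemma crossingI: "subseq [a, b, a, b] w \<Longrightarrow> a \<noteq> b \<Longrightarrow> crossing w"
  unfolding crossing_def by blast

lemma crossing_rotate1: "crossing w \<Longrightarrow> crossing (rotate1 w)"
proof -
  assume "crossing w"
  then obtain a b where ab: "a \<noteq> b" "subseq [a, b, a, b] w" by (auto simp: crossing_def)
  then obtain x v where w: "w = x # v" by (cases w) auto
  show ?thesis
  proof (cases "x = a")
    case True
    then have "subseq [b, a, b] v" using ab w by simp
    then have "subseq ([b, a, b] @ [a]) (v @ [a])"
      by (rule list_emb_append_mono) auto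
    then show ?thesis using ab w True crossingI[of b a] by simp
  next
    case False
    then have "subseq [a, b, a, b] v" using ab w by simp
    then have "subseq [a, b, a, b] (v @ [x])" by (rule list_emb_prefix)
    then show ?thesis using ab w by (auto simp: crossing_def)
  qed
qed

text \<open>Completing a full turn is again a rotation, so the one-sided
  \<open>crossing_rotate1\<close> gives both directions.\<close>

lemma crossing_rotate: "crossing (rotate k w) \<longleftrightarrow> crossing w"
proof -
  have 1: "crossing v \<Longrightarrow> crossing (rotate j v)" for j and v :: "'a list"
    by (induction j) (auto intro: crossing_rotate1)
  have 2: "rotate ((length w - k mod length w)) (rotate k w) = w" if "w \<noteq> []"
  proof -
    have lt: "k mod length w < length w" using that by simp
    have "rotate (length w - k mod length w) (rotate k w)
        = rotate (length w - k mod length w) (rotate (k mod length w) w)"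
      by (metis rotate_conv_mod)
    also have "\<dots> = rotate (length w - k mod length w + k mod length w) w"
      by (rule rotate_rotate)
    also have "\<dots> = w" using lt by simp
    finally show ?thesis .
  qed
  show ?thesis
  proof (cases "w = []")
    case False
    then show ?thesis using 1 2 by metis
  qed auto
qed

text \<open>The shortest suffix with a repetition starts with the repeated letter, and everything
  behind that head is distinct.\<close>

lemma closest_repetition:
  "\<not> distinct w \<Longrightarrow> \<exists>u a v z. w = u @ a # v @ a # z \<and> distinct v \<and> a \<notin> set v"
proof (induction w)
  case (Cons x w)
  show ?case
  proof (cases "distinct w")
    case True
    then have "x \<in> set w" using Cons.prems by simp
    then obtain v z where "w = v @ x # z" "x \<notin> set v" by (meson split_list_first)
    then show ?thesis using True by (intro exI[of _ "[]"] exI[of _ x] exI[of _ v] exI[of _ z]) auto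
  next
    case False
    then obtain u a v z where "w = u @ a # v @ a # z" "distinct v" "a \<notin> set v"
      using Cons.IH by blast
    then show ?thesis by (intro exI[of _ "x # u"]) auto
  qed
qed simp

lemma rotate_split: "rotate (length u) (u @ v) = v @ u"
  by (simp add: rotate_append)

text \<open>Between the two equal letters given by \<open>closest_repetition\<close> there is either
  nothing, which yields an adjacent pair, or a letter \<open>b\<close> that occurs once there.
  Another \<open>b\<close> outside would interlace with the two copies of \<open>a\<close>, so
  \<open>b\<close> is single in the whole word.\<close>

lemma noncrossing_reducible:
  assumes "\<not> crossing w" "w \<noteq> []"
  shows "\<exists>k a v. rotate k w = a # a # v \<or> rotate k w = a # v \<and> a \<notin> set v"
proof (cases "distinct w")
  case True
  then show ?thesis using assms(2)
    by (intro exI[of _ 0] exI[of _ "hd w"] exI[of _ "tl w"]) (cases w, auto)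
next
  case False
  then obtain u a v z where w: "w = u @ a # v @ a # z" "distinct v" "a \<notin> set v"
    using closest_repetition by blast
  show ?thesis
  proof (cases v)
    case Nil
    then have "rotate (length u) w = a # a # (z @ u)"
      using w rotate_split[of u "a # a # z"] by simp
    then show ?thesis by blast
  next
    case (Cons b v')
    have ab: "a \<noteq> b" using w Cons by auto
    have "b \<notin> set u"
    proof
      assume "b \<in> set u"
      then obtain u1 u2 where "u = u1 @ b # u2" by (meson split_list)
      then have "subseq ([] @ [b] @ [] @ [a] @ [b] @ [] @ [a] @ []) (u1 @ [b] @ u2 @ [a] @ [b] @ v' @ [a] @ z)"
        by (intro list_emb_append_mono) auto
      then have "subseq [b, a, b, a] w" using w Cons \<open>u = _\<close> by simp
      then show False using assms(1) ab crossingI[of b a] by simp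
    qed
    moreover have "b \<notin> set z"
    proof
      assume "b \<in> set z"
      then obtain z1 z2 where "z = z1 @ b # z2" by (meson split_list)
      then have "subseq ([] @ [a] @ [b] @ [] @ [a] @ [] @ [b] @ []) (u @ [a] @ [b] @ v' @ [a] @ z1 @ [b] @ z2)"
        by (intro list_emb_append_mono) auto
      then have "subseq [a, b, a, b] w" using w Cons \<open>z = _\<close> by simp
      then show False using assms(1) ab by (auto simp: crossing_def)
    qed
    ultimately have "b \<notin> set (v' @ a # z @ u @ [a])" using w Cons ab by auto
    moreover have "rotate (length (u @ [a])) w = b # (v' @ a # z @ u @ [a])"
      using w Cons rotate_split[of "u @ [a]" "b # v' @ a # z"] by simp
    ultimately show ?thesis by blast
  qed
qed

section \<open>Letters that may be prepended, and their stack\<close>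

text \<open>\<open>visible w\<close> consists of the letters of \<open>w\<close> that may be prepended to a noncrossing \<open>w\<close>
  without creating a crossing.\<close>

definition visible :: "'a list \<Rightarrow> 'a set" where
  "visible w = {a \<in> set w. \<forall>b. b \<noteq> a \<longrightarrow> \<not> subseq [b, a, b] w}"

text \<open>The sortedness condition orders the stack by position: all occurrences of a letter in
  \<open>w\<close> precede those of the letters below it.\<close>

definition is_stack :: "'a list \<Rightarrow> 'a list \<Rightarrow> bool" where
  "is_stack w s \<longleftrightarrow> distinct s \<and> set s = visible w \<and> sorted_wrt (\<lambda>c d. \<not> subseq [d, c] w) s"

fun stack :: "'a list \<Rightarrow> 'a list" where
  "stack [] = []"
| "stack (a # w) = (if a \<in> set (stack w) then dropWhile (\<lambda>c. c \<noteq> a) (stack w) else a # stack w)"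

lemma visible_subset: "visible w \<subseteq> set w" by (auto simp: visible_def)

lemma subseq_set: "subseq u w \<Longrightarrow> set u \<subseteq> set w"
  by (auto elim: list_emb_set)

text \<open>A crossing that is not already in \<open>w\<close> uses the prepended \<open>a\<close>
  as its first letter; what remains is a pattern \<open>b a b\<close> in \<open>w\<close>, and such
  a pattern is what hides \<open>a\<close>.\<close>

lemma crossing_Cons:
  "crossing (a # w) \<longleftrightarrow> crossing w \<or> a \<in> set w - visible w"
proof
  assume "crossing (a # w)"
  then obtain c b where cb: "c \<noteq> b" "subseq [c, b, c, b] (a # w)" by (auto simp: crossing_def)
  show "crossing w \<or> a \<in> set w - visible w"
  proof (cases "c = a")
    case True
    then have "subseq [b, a, b] w" using cb by simp
    then show ?thesis using cb True subseq_set[of "[b, a, b]" w] by (auto simp: visible_def)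
  next
    case False
    then show ?thesis using cb by (auto simp: crossing_def)
  qed
next
  assume "crossing w \<or> a \<in> set w - visible w"
  then show "crossing (a # w)"
  proof
    assume "crossing w"
    then show ?thesis unfolding crossing_def by (meson list_emb_Cons)
  next
    assume "a \<in> set w - visible w"
    then obtain b where "b \<noteq> a" "subseq [b, a, b] w" by (auto simp: visible_def)
    then show ?thesis using crossingI[of a b "a # w"] by simp
  qed
qed

text \<open>New hiding patterns start with the prepended letter: \<open>a c a\<close> arises when
  some \<open>c\<close> stands before an \<open>a\<close> in \<open>w\<close>.\<close>

lemma visible_Cons:
  assumes "\<not> crossing (a # w)"
  shows "visible (a # w) = insert a {c \<in> visible w. \<not> subseq [c, a] w}"
proof -
  have "a \<in> visible (a # w)"
  proof -
    have "\<not> subseq [b, a, b] w" if "b \<noteq> a" for b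
      using assms that unfolding crossing_def by (metis subseq_Cons2)
    then show ?thesis by (auto simp: visible_def)
  qed
  moreover have "c \<in> visible (a # w) \<longleftrightarrow> c \<in> visible w \<and> \<not> subseq [c, a] w" if "c \<noteq> a" for c
  proof -
    have 1: "subseq [b, c, b] (a # w) \<longleftrightarrow> (if b = a then subseq [c, a] w else subseq [b, c, b] w)" for b
      by simp
    have 2: "subseq [a, c, a] w \<Longrightarrow> subseq [c, a] w"
      by (meson subseq_Cons')
    show ?thesis using that unfolding visible_def mem_Collect_eq 1 using 2 by auto
  qed
  ultimately have "c \<in> visible (a # w) \<longleftrightarrow> c \<in> insert a {c \<in> visible w. \<not> subseq [c, a] w}" for c
    by (cases "c = a") auto
  then show ?thesis by (rule Set.set_eqI)
qed

lemma crossing_dup: "crossing (a # a # v) \<longleftrightarrow> crossing (a # v)"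
  using visible_Cons[of a v] by (auto simp: crossing_Cons[of a "a # v"])

lemma crossing_singleton: "a \<notin> set v \<Longrightarrow> crossing (a # v) \<longleftrightarrow> crossing v"
  by (simp add: crossing_Cons)

lemma subseq_pair_order:
  assumes "a \<in> set w" "b \<in> set w" "a \<noteq> b" shows "subseq [a, b] w \<or> subseq [b, a] w"
  using assms by (induction w) (auto simp: subseq_singleton_left)

text \<open>When a visible \<open>a\<close> is prepended, the letters above it on the stack stand
  before an \<open>a\<close> in \<open>w\<close> and become hidden, while those below stand after
  every \<open>a\<close> and stay visible. Hence the stack is popped down to \<open>a\<close>. A new
  letter hides nothing.\<close>

lemma is_stack_stack: "\<not> crossing w \<Longrightarrow> is_stack w (stack w)"
proof (induction w)
  case Nil
  then show ?case by (auto simp: is_stack_def visible_def)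
next
  case (Cons a w)
  then have "\<not> crossing w" by (simp add: crossing_Cons)
  then have IH: "distinct (stack w)" "set (stack w) = visible w"
      "sorted_wrt (\<lambda>c d. \<not> subseq [d, c] w) (stack w)"
    using Cons.IH by (auto simp: is_stack_def)
  show ?case
  proof (cases "a \<in> set (stack w)")
    case True
    then obtain u v where uv: "stack w = u @ a # v" "a \<notin> set u" by (meson split_list_first)
    have st: "stack (a # w) = a # v" using True uv by (simp add: dropWhile_append2 dropWhile_append)
    have D: "distinct (a # v)" "a \<notin> set v" using IH(1) uv by auto
    have u1: "subseq [c, a] w" if "c \<in> set u" for c
    proof -
      have "\<not> subseq [a, c] w" using IH(3) uv that by (auto simp: sorted_wrt_append)
      moreover have "c \<in> set w" "a \<in> set w" using IH(2) uv that visible_subset[of w] by auto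
      ultimately show ?thesis using subseq_pair_order[of a w c] uv that by auto
    qed
    have v1: "\<not> subseq [c, a] w" if "c \<in> set v" for c
      using IH(3) uv that by (auto simp: sorted_wrt_append)
    have V: "visible (a # w) = set (a # v)"
    proof -
      have "visible w = insert a (set u \<union> set v)" using IH(2) uv by auto
      then show ?thesis using visible_Cons[OF Cons.prems] u1 v1 by auto
    qed
    have "sorted_wrt (\<lambda>c d. \<not> subseq [d, c] w) v" using IH(3) uv by (auto simp: sorted_wrt_append)
    then have "sorted_wrt (\<lambda>c d. \<not> subseq [d, c] (a # w)) v"
      by (rule sorted_wrt_mono_rel[rotated]) (use D in auto)
    moreover have "\<forall>d\<in>set v. \<not> subseq [d, a] (a # w)" using v1 D by auto
    ultimately show ?thesis unfolding is_stack_def st using D V by auto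
  next
    case False
    then have aw: "a \<notin> set w" using Cons.prems IH(2) by (auto simp: crossing_Cons)
    have na: "\<not> subseq [c, a] w" for c using aw subseq_set[of "[c, a]" w] by auto
    have V: "visible (a # w) = set (a # stack w)"
      using visible_Cons[OF Cons.prems] na IH(2) by auto
    have "sorted_wrt (\<lambda>c d. \<not> subseq [d, c] (a # w)) (stack w)"
      using IH(3) by (rule sorted_wrt_mono_rel[rotated]) (use False in auto)
    moreover have "\<forall>d\<in>set (stack w). \<not> subseq [d, a] (a # w)" using na False by auto
    ultimately show ?thesis unfolding is_stack_def using False V IH(1) by auto
  qed
qed

lemma length_stack_le: "length (stack w) \<le> length w"
proof (induction w)
  case (Cons a w)
  then show ?case using length_dropWhile_le[of "\<lambda>c. c \<noteq> a" "stack w"] by auto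
qed simp

section \<open>Counting noncrossing words\<close>

definition words :: "nat \<Rightarrow> nat \<Rightarrow> nat list set" where
  "words p l = {w. length w = l \<and> set w \<subseteq> {..<p}}"

lemma finite_words [simp]: "finite (words p l)"
proof -
  have "words p l = {w. set w \<subseteq> {..<p} \<and> length w = l}" by (auto simp: words_def)
  then show ?thesis using finite_lists_length_eq[of "{..<p}" l] by simp
qed

lemma words_0 [simp]: "words p 0 = {[]}" by (auto simp: words_def)

lemma sum_words_Suc: "(\<Sum>w\<in>words p (Suc l). F w) = (\<Sum>w\<in>words p l. \<Sum>a<p. F (a # w))"
proof -
  have "(\<Sum>w\<in>words p (Suc l). F w) = (\<Sum>(w, a)\<in>words p l \<times> {..<p}. F (a # w))"
    by (rule sum.reindex_bij_witness[of _ "\<lambda>(w, a). a # w" "\<lambda>w. (tl w, hd w)"])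
      (auto simp: words_def length_Suc_conv)
  then show ?thesis by (simp add: sum.cartesian_product)
qed

lemma sum_dropWhile_heights:
  fixes g :: "nat \<Rightarrow> 'a::comm_monoid_add"
  assumes "distinct s"
  shows "(\<Sum>a\<in>set s. g (length (dropWhile (\<lambda>c. c \<noteq> a) s))) = (\<Sum>j=1..length s. g j)"
  using assms
proof (induction s)
  case (Cons b s)
  have "(\<Sum>a\<in>set s. g (length (dropWhile (\<lambda>c. c \<noteq> a) (b # s))))
      = (\<Sum>a\<in>set s. g (length (dropWhile (\<lambda>c. c \<noteq> a) s)))"
    using Cons.prems by (intro sum.cong) auto
  then show ?case using Cons by (simp add: add.commute)
qed simp

text \<open>Prepending a visible letter pops the stack down to it, giving each height from 1 to the
  current one exactly once; prepending a new letter raises the height by one.\<close>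

lemma sum_noncrossing_words_Suc:
  fixes g :: "nat \<Rightarrow> nat \<Rightarrow> real"
  shows "(\<Sum>w | w \<in> words p (Suc l) \<and> \<not> crossing w. g (card (set w)) (length (stack w)))
    = (\<Sum>w | w \<in> words p l \<and> \<not> crossing w.
         real (p - card (set w)) * g (Suc (card (set w))) (Suc (length (stack w)))
         + (\<Sum>j=1..length (stack w). g (card (set w)) j))"
proof -
  define F where "F w = (if crossing w then 0 else g (card (set w)) (length (stack w)))" for w :: "nat list"
  have inner: "(\<Sum>a<p. F (a # w)) = (if crossing w then 0 else
         real (p - card (set w)) * g (Suc (card (set w))) (Suc (length (stack w)))
         + (\<Sum>j=1..length (stack w). g (card (set w)) j))" if w: "w \<in> words p l" for w
  proof (cases "crossing w")
    case True
    then show ?thesis by (simp add: F_def crossing_Cons)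
  next
    case False
    have st: "distinct (stack w)" "set (stack w) = visible w"
      using is_stack_stack[OF False] by (auto simp: is_stack_def)
    have sub: "visible w \<subseteq> set w" "set w \<subseteq> {..<p}" using w visible_subset[of w] by (auto simp: words_def)
    \<comment> \<open>Letters that occur in \<open>w\<close> without being visible create a crossing
      and contribute zero.\<close>
    have "(\<Sum>a<p. F (a # w)) = (\<Sum>a\<in>({..<p} - set w) \<union> visible w. F (a # w))"
      using sub False by (intro sum.mono_neutral_right) (auto simp: F_def crossing_Cons)
    also have "\<dots> = (\<Sum>a\<in>{..<p} - set w. F (a # w)) + (\<Sum>a\<in>visible w. F (a # w))"
      using sub by (intro sum.union_disjoint) (auto intro: finite_subset)
    also have "(\<Sum>a\<in>{..<p} - set w. F (a # w))
        = (\<Sum>a\<in>{..<p} - set w. g (Suc (card (set w))) (Suc (length (stack w))))"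
      using sub False st by (intro sum.cong) (auto simp: F_def crossing_Cons)
    also have "\<dots> = real (p - card (set w)) * g (Suc (card (set w))) (Suc (length (stack w)))"
      using sub by (simp add: card_Diff_subset)
    also have "(\<Sum>a\<in>visible w. F (a # w))
        = (\<Sum>a\<in>set (stack w). g (card (set w)) (length (dropWhile (\<lambda>c. c \<noteq> a) (stack w))))"
      using sub False st by (intro sum.cong) (auto simp: F_def crossing_Cons insert_absorb subset_iff)
    also have "\<dots> = (\<Sum>j=1..length (stack w). g (card (set w)) j)"
      using sum_dropWhile_heights[OF st(1), of "g (card (set w))"] by simp
    finally show ?thesis using False by simp
  qed
  have "(\<Sum>w | w \<in> words p (Suc l) \<and> \<not> crossing w. g (card (set w)) (length (stack w)))
      = (\<Sum>w\<in>words p (Suc l). F w)"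
    unfolding F_def by (intro sum.mono_neutral_cong_left) auto
  also have "\<dots> = (\<Sum>w\<in>words p l. \<Sum>a<p. F (a # w))" by (rule sum_words_Suc)
  also have "\<dots> = (\<Sum>w | w \<in> words p l \<and> \<not> crossing w.
         real (p - card (set w)) * g (Suc (card (set w))) (Suc (length (stack w)))
         + (\<Sum>j=1..length (stack w). g (card (set w)) j))"
    using inner by (intro sum.mono_neutral_cong_right) auto
  finally show ?thesis .
qed

text \<open>Here \<open>r\<close> counts the positions that repeat a letter: a new letter keeps it,
  a visible old letter raises it by one. The equation \<open>card (set w) + r = l\<close> avoids
  truncated subtraction.\<close>

definition nc_count :: "nat \<Rightarrow> nat \<Rightarrow> nat \<Rightarrow> nat \<Rightarrow> real" where
  "nc_count p l r h = (\<Sum>w | w \<in> words p l \<and> \<not> crossing w.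
     of_bool (card (set w) + r = l \<and> length (stack w) = h))"

lemma nc_count_Suc:
  "nc_count p (Suc l) r (Suc h) = real (p - (l - r)) * nc_count p l r h
     + (case r of 0 \<Rightarrow> 0 | Suc r' \<Rightarrow> \<Sum>h'=Suc h..l. nc_count p l r' h')"
proof -
  let ?N = "{w. w \<in> words p l \<and> \<not> crossing w}"
  have "nc_count p (Suc l) r (Suc h) = (\<Sum>w\<in>?N.
      real (p - card (set w)) * of_bool (Suc (card (set w)) + r = Suc l \<and> Suc (length (stack w)) = Suc h)
      + (\<Sum>j=1..length (stack w). of_bool (card (set w) + r = Suc l \<and> j = Suc h)))"
    unfolding nc_count_def
    by (rule sum_noncrossing_words_Suc[of "\<lambda>k j. of_bool (k + r = Suc l \<and> j = Suc h)"])
  also have "\<dots> = (\<Sum>w\<in>?N.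
      real (p - (l - r)) * of_bool (card (set w) + r = l \<and> length (stack w) = h)
      + (case r of 0 \<Rightarrow> 0 | Suc r' \<Rightarrow> \<Sum>h'=Suc h..l. of_bool (card (set w) + r' = l \<and> length (stack w) = h')))"
  proof (rule sum.cong, goal_cases)
    case (2 w)
    have lw: "length w = l" using 2 by (auto simp: words_def)
    have L: "length (stack w) \<le> l" using length_stack_le[of w] lw by simp
    have C: "card (set w) \<le> l" using card_length[of w] lw by simp
    \<comment> \<open>A pop reaches height \<open>Suc h\<close> exactly when the old stack is at
      least that high, and then for exactly one letter.\<close>
    have J: "(\<Sum>j=1..length (stack w). of_bool (P \<and> j = Suc h))
        = (\<Sum>h'=Suc h..l. of_bool (P \<and> length (stack w) = h') :: real)" for P
      using L by (cases P) (auto simp: of_bool_def sum.delta sum.delta')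
    have "(\<Sum>j=1..length (stack w). of_bool (card (set w) + r = Suc l \<and> j = Suc h) :: real)
       = (case r of 0 \<Rightarrow> 0 | Suc r' \<Rightarrow> \<Sum>h'=Suc h..l. of_bool (card (set w) + r' = l \<and> length (stack w) = h'))"
      using C J by (cases r) auto
    then show ?case by auto
  qed simp
  also have "\<dots> = real (p - (l - r)) * nc_count p l r h
     + (case r of 0 \<Rightarrow> 0 | Suc r' \<Rightarrow> \<Sum>h'=Suc h..l. nc_count p l r' h')"
  proof (cases r)
    case 0
    then show ?thesis by (simp add: nc_count_def sum_distrib_left)
  next
    case (Suc r')
    have "(\<Sum>w\<in>?N. \<Sum>h'=Suc h..l. of_bool (card (set w) + r' = l \<and> length (stack w) = h'))
       = (\<Sum>h'=Suc h..l. nc_count p l r' h')"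
      unfolding nc_count_def by (rule sum.swap)
    then show ?thesis using Suc unfolding sum.distrib sum_distrib_left[symmetric] nc_count_def by simp
  qed
  finally show ?thesis .
qed

lemma nc_count_Suc_0: "nc_count p (Suc l) r 0 = 0"
proof -
  have "stack w \<noteq> []" if "w \<in> words p (Suc l)" for w
    using that by (cases w) (auto simp: words_def dropWhile_eq_Nil_conv)
  then show ?thesis unfolding nc_count_def by (intro sum.neutral) auto
qed

section \<open>Closed form of the counts and Narayana numbers\<close>

text \<open>The closed form of the recurrence for \<open>nc_count\<close>; summing it over \<open>h\<close> gives the
  determinant form of the Narayana numbers.\<close>

definition nc_shape :: "nat \<Rightarrow> nat \<Rightarrow> nat \<Rightarrow> real" where
  "nc_shape l r h = real ((l - 1) choose r) * real ((l - h) choose r)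
     - real (l choose r) * (if h < l then real ((l - h - 1) choose r) else 0)"

text \<open>Hockey-stick identity after reversing the index; \<open>a = Suc l\<close> is the empty
  sum.\<close>

lemma sum_choose_diff:
  assumes "a \<le> Suc l"
  shows "(\<Sum>h=a..l. real ((l - h) choose r)) = real ((Suc l - a) choose Suc r)"
proof (cases "a \<le> l")
  case True
  have "(\<Sum>h=a..l. real ((l - h) choose r)) = (\<Sum>i=0..l - a. real (i choose r))"
    using True by (intro sum.reindex_bij_witness[of _ "\<lambda>i. l - i" "\<lambda>h. l - h"]) auto
  also have "\<dots> = real (\<Sum>i=0..l - a. i choose r)" by simp
  also have "\<dots> = real (Suc (l - a) choose Suc r)" by (simp only: sum_choose_upper atLeast0AtMost)
  finally show ?thesis using True by (simp add: Suc_diff_le)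
qed (use assms in auto)

lemma sum_nc_shape:
  assumes "l \<ge> 1" "a \<le> l"
  shows "(\<Sum>h=a..l. nc_shape l r h) = real ((l - 1) choose r) * real ((Suc l - a) choose Suc r)
     - real (l choose r) * real ((l - a) choose Suc r)"
proof -
  have "(\<Sum>h=a..l. if h < l then real ((l - h - 1) choose r) else 0)
      = (\<Sum>h=a..l - 1. real ((l - 1 - h) choose r))"
    using assms by (intro sum.mono_neutral_cong_right) auto
  also have "\<dots> = real ((l - a) choose Suc r)"
    using assms sum_choose_diff[of a "l - 1" r] by auto
  finally show ?thesis using assms sum_choose_diff[of a l r]
    unfolding nc_shape_def sum_subtractf sum_distrib_left[symmetric] by auto
qed

text \<open>The falling factorial. For \<open>k > p\<close> the factor at \<open>i = p\<close>
  vanishes, so truncated subtraction does no harm.\<close>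

definition ffact :: "nat \<Rightarrow> nat \<Rightarrow> real" where
  "ffact p k = (\<Prod>i<k. real (p - i))"

lemma ffact_Suc: "ffact p (Suc k) = ffact p k * real (p - k)"
  by (simp add: ffact_def)

text \<open>The closed form satisfies the recurrence \<open>nc_count_Suc\<close>: a new letter
  supplies the next factor of \<open>ffact\<close>, and \<open>sum_nc_shape\<close> evaluates the
  pops. For larger \<open>h\<close> truncation would make \<open>nc_shape\<close> equal to 1 at
  \<open>r = 0\<close>, although no such word exists.\<close>

lemma nc_count_eq:
  "h \<le> Suc l \<Longrightarrow> nc_count p (Suc l) r h = ffact p (Suc l - r) * nc_shape (Suc l) r h"
proof (induction l arbitrary: r h)
  case 0
  have base: "nc_count p 0 r h = of_bool (r = 0 \<and> h = 0)" for r h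
  proof -
    have "{w. w \<in> words p 0 \<and> \<not> crossing w} = {[]}" by (auto simp: crossing_def)
    then show ?thesis unfolding nc_count_def by auto
  qed
  show ?case
  proof (cases h)
    case 0
    then show ?thesis by (simp add: nc_count_Suc_0 nc_shape_def)
  next
    case (Suc h')
    then have "h' = 0" using 0 by simp
    then show ?thesis using Suc
      by (cases r) (auto simp: nc_count_Suc base nc_shape_def ffact_def)
  qed
next
  case (Suc l)
  show ?case
  proof (cases h)
    case 0
    then show ?thesis by (simp add: nc_count_Suc_0 nc_shape_def)
  next
    case h: (Suc h')
    then have h': "h' \<le> Suc l" using Suc.prems by simp
    have A: "real (p - (Suc l - r)) * nc_count p (Suc l) r h'
        = ffact p (Suc (Suc l) - r) * nc_shape (Suc l) r h'"
    proof (cases "r \<le> Suc l")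
      case True
      then show ?thesis using Suc.IH[OF h'] by (simp add: Suc_diff_le ffact_Suc)
    next
      case False
      then show ?thesis using Suc.IH[OF h', of r] by (simp add: nc_shape_def binomial_eq_0)
    qed
    show ?thesis
    proof (cases r)
      case 0
      then show ?thesis using A h h' by (auto simp: nc_count_Suc nc_shape_def)
    next
      case r: (Suc r')
      have "(\<Sum>j=Suc h'..Suc l. nc_count p (Suc l) r' j)
          = ffact p (Suc l - r') * (\<Sum>j=Suc h'..Suc l. nc_shape (Suc l) r' j)"
        unfolding sum_distrib_left by (intro sum.cong Suc.IH) auto
      also have "(\<Sum>j=Suc h'..Suc l. nc_shape (Suc l) r' j)
          = real (l choose r') * real ((Suc l - h') choose r) - real (Suc l choose r') * real ((l - h') choose r)"
      proof (cases "h' = Suc l")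
        case False
        then show ?thesis using h' r sum_nc_shape[of "Suc l" "Suc h'" r'] by (simp add: Suc_diff_le)
      qed (use r in auto)
      finally have B: "nc_count p (Suc (Suc l)) r h = ffact p (Suc (Suc l) - r) * (nc_shape (Suc l) r h' +
          real (l choose r') * real ((Suc l - h') choose r) - real (Suc l choose r') * real ((l - h') choose r))"
        using A h r by (simp add: nc_count_Suc algebra_simps)
      \<comment> \<open>Pascal's rule in the binomials that do not involve the height accounts for
        the two extra products.\<close>
      have "nc_shape (Suc l) r h' + real (l choose r') * real ((Suc l - h') choose r)
            - real (Suc l choose r') * real ((l - h') choose r) = nc_shape (Suc (Suc l)) r h"
        using h h' r by (cases "h' = Suc l") (auto simp: nc_shape_def algebra_simps)
      then show ?thesis using B by (simp add: algebra_simps)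
    qed
  qed
qed

text \<open>For \<open>l > 0\<close> this is the number of noncrossing partitions of an
  \<open>l\<close>-element set into \<open>i + 1\<close> blocks.\<close>

definition narayana :: "nat \<Rightarrow> nat \<Rightarrow> real" where
  "narayana l i = real (l choose i) * real ((l - 1) choose i) / real (i + 1)"

text \<open>Binomial symmetry expresses all entries through \<open>a\<close>, \<open>b\<close> and
  \<open>c\<close>; the absorption identities \<open>e2\<close> and \<open>e3\<close> then collapse
  the determinant to \<open>c * a / Suc i\<close>.\<close>

lemma narayana_det:
  assumes "i < l"
  shows "real ((l - 1) choose (l - Suc i)) * real (Suc l choose Suc (l - Suc i))
     - real (l choose (l - Suc i)) * real (l choose Suc (l - Suc i)) = narayana l i"
proof -
  obtain d where l: "l = Suc (i + d)" using assms less_iff_Suc_add by auto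
  have s1: "(i + d) choose d = (i + d) choose i" by (metis add_diff_cancel_right' binomial_symmetric le_add2)
  have s2: "Suc (i + d) choose d = Suc (i + d) choose Suc i"
    by (metis add_Suc add_diff_cancel_right' binomial_symmetric le_add2)
  have s3: "Suc (i + d) choose Suc d = Suc (i + d) choose i"
    by (metis add_Suc_right add_diff_cancel_right' binomial_symmetric le_add2)
  have s4: "Suc (Suc (i + d)) choose Suc d = (Suc (i + d) choose Suc i) + (Suc (i + d) choose i)"
    using s2 s3 by simp
  define a where "a = real ((i + d) choose i)"
  define b where "b = real ((i + d) choose Suc i)"
  define c where "c = real (Suc (i + d) choose i)"
  have e1: "real (Suc (i + d) choose Suc i) = a + b" by (simp add: a_def b_def)
  have e2: "real (Suc i) * b = real d * a"
  proof -
    have "Suc i * ((i + d) choose Suc i) = ((i + d) choose i) * (i + d - i)"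
      by (metis binomial_absorb_comp binomial_absorption diff_Suc_1 mult.commute)
    then have "real (Suc i * ((i + d) choose Suc i)) = real (((i + d) choose i) * (i + d - i))" by (rule arg_cong)
    then show ?thesis unfolding a_def b_def of_nat_mult by (simp add: mult.commute)
  qed
  have e3: "real (Suc i) * (a + b) = real (Suc d) * c"
  proof -
    have "Suc i * (Suc (i + d) choose Suc i) = (Suc (i + d) choose i) * (Suc (i + d) - i)"
      by (metis binomial_absorb_comp binomial_absorption diff_Suc_1 mult.commute)
    then have "real (Suc i * (Suc (i + d) choose Suc i)) = real ((Suc (i + d) choose i) * (Suc (i + d) - i))"
      by (rule arg_cong)
    then show ?thesis unfolding of_nat_mult e1 c_def by (simp add: mult.commute)
  qed
  have key: "real (Suc i) * (a * (a + b + c) - (a + b) * c) = c * a"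
  proof -
    have "real (Suc i) * (a * (a + b + c) - (a + b) * c)
        = a * (real (Suc i) * (a + b)) - c * (real (Suc i) * b)" by (simp add: algebra_simps)
    also have "\<dots> = c * a" unfolding e2 e3 by (simp add: algebra_simps)
    finally show ?thesis .
  qed
  have "real ((l - 1) choose (l - Suc i)) * real (Suc l choose Suc (l - Suc i))
     - real (l choose (l - Suc i)) * real (l choose Suc (l - Suc i)) = a * (a + b + c) - (a + b) * c"
    using l s1 s2 s3 s4 e1 by (simp add: a_def c_def del: binomial_Suc_Suc)
  also have "\<dots> = c * a / real (Suc i)" using key by (simp add: field_simps del: of_nat_Suc)
  finally show ?thesis using l by (simp add: narayana_def a_def c_def)
qed

lemma sum_noncrossing_weight:
  fixes q :: real
  assumes "l > 0"
  shows "(\<Sum>w | w \<in> words p l \<and> \<not> crossing w. q ^ card (set w))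
     = (\<Sum>i<l. q ^ Suc i * ffact p (Suc i) * narayana l i)"
proof -
  let ?N = "{w. w \<in> words p l \<and> \<not> crossing w}"
  have cnt: "nc_count p l r h = ffact p (l - r) * nc_shape l r h" if "h \<le> l" for r h
    using nc_count_eq[of h "l - 1" p r] assms that by simp
  have "(\<Sum>w\<in>?N. q ^ card (set w))
      = (\<Sum>w\<in>?N. \<Sum>r\<le>l. \<Sum>h=0..l. q ^ (l - r) * of_bool (card (set w) + r = l \<and> length (stack w) = h))"
  proof (rule sum.cong, goal_cases)
    case (2 w)
    have lw: "length w = l" using 2 by (auto simp: words_def)
    have L: "length (stack w) \<le> l" using length_stack_le[of w] lw by simp
    have C: "card (set w) \<le> l" using card_length[of w] lw by simp
    have "(\<Sum>r\<le>l. \<Sum>h=0..l. q ^ (l - r) * of_bool (card (set w) + r = l \<and> length (stack w) = h))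
        = (\<Sum>r\<le>l. if r = l - card (set w) then q ^ (l - r) else 0)"
    proof (rule sum.cong, goal_cases)
      case (2 r)
      have "(\<Sum>h=0..l. q ^ (l - r) * of_bool (card (set w) + r = l \<and> length (stack w) = h))
         = (\<Sum>h=0..l. if length (stack w) = h then q ^ (l - r) * of_bool (card (set w) + r = l) else 0)"
        by (intro sum.cong) auto
      also have "\<dots> = q ^ (l - r) * of_bool (card (set w) + r = l)" using L by simp
      finally show ?case using C by auto
    qed simp
    also have "\<dots> = q ^ card (set w)" using C by simp
    finally show ?case by simp
  qed simp
  also have "\<dots> = (\<Sum>r\<le>l. \<Sum>h=0..l. q ^ (l - r) * nc_count p l r h)"
    unfolding nc_count_def sum_distrib_left
    by (subst sum.swap, rule sum.cong, simp, rule sum.swap)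
  also have "\<dots> = (\<Sum>r\<le>l. q ^ (l - r) * ffact p (l - r) * (\<Sum>h=0..l. nc_shape l r h))"
    unfolding sum_distrib_left by (intro sum.cong) (auto simp: cnt)
  \<comment> \<open>The term \<open>r = l\<close> would belong to a word without letters; both
    products of its \<open>nc_shape\<close> sum vanish.\<close>
  also have "\<dots> = (\<Sum>r<l. q ^ (l - r) * ffact p (l - r) * (\<Sum>h=0..l. nc_shape l r h))"
    using sum_nc_shape[of l 0 l] assms by (simp add: binomial_eq_0 flip: lessThan_Suc_atMost)
  also have "\<dots> = (\<Sum>i<l. q ^ Suc i * ffact p (Suc i) * narayana l i)"
  proof (rule sum.reindex_bij_witness[of _ "\<lambda>i. l - Suc i" "\<lambda>r. l - Suc r"], goal_cases)
    case (5 r)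
    then have "(\<Sum>h=0..l. nc_shape l r h) = narayana l (l - Suc r)"
      using sum_nc_shape[of l 0 r] narayana_det[of "l - Suc r" l] by (simp add: Suc_diff_Suc)
    moreover have "Suc (l - Suc r) = l - r" using 5 by auto
    ultimately show ?case by simp
  qed auto
  finally show ?thesis .
qed

section \<open>Estimates for word weights and falling factorials\<close>

text \<open>Relative to the weight of a word, all new letters together contribute at most
  \<open>real p * q\<close>, hence at most 1, and each of the at most \<open>Suc l\<close> old
  letters contributes 1; this produces the factorial. The factor \<open>real p * q\<close> of the
  first letter is kept to cancel \<open>n / p\<close> in the expectation.\<close>

lemma sum_words_weight_le:
  fixes q :: real
  assumes "q \<ge> 0" "real p * q \<le> 1"
  shows "(\<Sum>w\<in>words p (Suc l). q ^ card (set w)) \<le> fact (Suc l) * (real p * q)"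
proof (induction l)
  case 0
  then show ?case by (simp add: sum_words_Suc)
next
  case (Suc l)
  have "(\<Sum>w\<in>words p (Suc (Suc l)). q ^ card (set w))
      = (\<Sum>w\<in>words p (Suc l). \<Sum>a<p. q ^ card (set (a # w)))" by (rule sum_words_Suc)
  also have "\<dots> \<le> (\<Sum>w\<in>words p (Suc l). real (Suc (Suc l)) * q ^ card (set w))"
  proof (rule sum_mono)
    fix w assume w: "w \<in> words p (Suc l)"
    let ?k = "card (set w)"
    have sub: "set w \<subseteq> {..<p}" and k: "?k \<le> Suc l" using w card_length[of w] by (auto simp: words_def)
    have "(\<Sum>a<p. q ^ card (set (a # w)))
        = (\<Sum>a\<in>{..<p} - set w. q ^ card (set (a # w))) + (\<Sum>a\<in>set w. q ^ card (set (a # w)))"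
      using sub by (intro sum.subset_diff) auto
    also have "(\<Sum>a\<in>set w. q ^ card (set (a # w))) = real ?k * q ^ ?k"
      by (simp add: insert_absorb)
    also have "(\<Sum>a\<in>{..<p} - set w. q ^ card (set (a # w))) = (\<Sum>a\<in>{..<p} - set w. q ^ Suc ?k)"
      by (intro sum.cong) auto
    also have "\<dots> = real (p - ?k) * q ^ Suc ?k" using sub by (simp add: card_Diff_subset)
    also have "\<dots> = (real (p - ?k) * q) * q ^ ?k" by simp
    also have "\<dots> \<le> 1 * q ^ ?k"
    proof (rule mult_right_mono)
      have "real (p - ?k) * q \<le> real p * q" using assms(1) by (intro mult_right_mono) auto
      then show "real (p - ?k) * q \<le> 1" using assms(2) by linarith
    qed (use assms in simp)
    finally have "(\<Sum>a<p. q ^ card (set (a # w))) \<le> real (Suc ?k) * q ^ ?k" by (simp add: algebra_simps)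
    also have "\<dots> \<le> real (Suc (Suc l)) * q ^ ?k" using k assms by (intro mult_right_mono) auto
    finally show "(\<Sum>a<p. q ^ card (set (a # w))) \<le> real (Suc (Suc l)) * q ^ ?k" .
  qed
  also have "\<dots> = real (Suc (Suc l)) * (\<Sum>w\<in>words p (Suc l). q ^ card (set w))"
    by (simp only: sum_distrib_left)
  also have "\<dots> \<le> real (Suc (Suc l)) * (fact (Suc l) * (real p * q))"
    using Suc by (intro mult_left_mono) auto
  finally show ?case by (simp add: algebra_simps)
qed

text \<open>Replacing \<open>p - k\<close> by \<open>p\<close> in one factor costs at most
  \<open>real k * q\<close>, and these costs add up to a quadratic in \<open>k\<close>. Again
  \<open>real p * q\<close> is retained in the error to cancel \<open>n / p\<close>.\<close>

lemma ffact_approx: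
  fixes q :: real
  assumes "q \<ge> 0" "real p * q \<le> 1"
  shows "0 \<le> ffact p k * q ^ k \<and> ffact p k * q ^ k \<le> (real p * q) ^ k \<and>
    (real p * q) ^ k - ffact p k * q ^ k \<le> real k ^ 2 * (real p * q) * q"
proof (induction k)
  case 0
  then show ?case by (simp add: ffact_def)
next
  case (Suc k)
  define y where "y = real p * q"
  define Q where "Q = ffact p k * q ^ k"
  define z where "z = real (p - k) * q"
  have y: "0 \<le> y" "y \<le> 1" using assms by (auto simp: y_def)
  have z: "0 \<le> z" "z \<le> y" "y - z \<le> real k * q"
  proof -
    show "0 \<le> z" using assms by (simp add: z_def)
    show "z \<le> y" unfolding z_def y_def using assms by (intro mult_right_mono) auto
    have "real p - real (p - k) \<le> real k" by simp
    then have "(real p - real (p - k)) * q \<le> real k * q" using assms(1) by (intro mult_right_mono) auto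
    then show "y - z \<le> real k * q" by (simp add: y_def z_def algebra_simps)
  qed
  have IH: "0 \<le> Q" "Q \<le> y ^ k" "y ^ k - Q \<le> real k ^ 2 * y * q" using Suc by (auto simp: Q_def y_def)
  have eq: "ffact p (Suc k) * q ^ Suc k = Q * z" by (simp add: ffact_Suc Q_def z_def)
  have 1: "0 \<le> Q * z" using IH z by simp
  have 2: "Q * z \<le> y ^ Suc k" using mult_mono[OF IH(2) z(2)] IH z y by (simp add: mult.commute)
  \<comment> \<open>The bound \<open>y ^ k \<le> y\<close> requires \<open>k \<ge> 1\<close>; the
    factor \<open>real k\<close> covers \<open>k = 0\<close>.\<close>
  have Qk: "Q * real k \<le> y * real k"
  proof (cases k)
    case (Suc k')
    have "y ^ k \<le> y" using y Suc power_decreasing[of 1 k y] by simp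
    then show ?thesis using IH by (intro mult_right_mono) auto
  qed simp
  have "y ^ Suc k - Q * z = (y ^ k - Q) * y + Q * (y - z)" by (simp add: algebra_simps)
  also have "\<dots> \<le> (y ^ k - Q) * 1 + Q * (real k * q)"
    using IH y z by (intro add_mono mult_left_mono) auto
  also have "\<dots> \<le> real k ^ 2 * y * q + y * real k * q"
    using IH mult_right_mono[OF Qk assms(1)] by (intro add_mono) (auto simp: algebra_simps)
  also have "\<dots> = (real k ^ 2 + real k) * (y * q)" by (simp add: algebra_simps)
  also have "\<dots> \<le> real (Suc k) ^ 2 * (y * q)"
    using y assms by (intro mult_right_mono) (auto simp: power2_eq_square algebra_simps)
  finally show ?case using 1 2 eq unfolding y_def[symmetric] by (simp add: mult.assoc)
qed

section \<open>Cyclic sums of a tight frame kernel\<close>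

fun walk :: "('i \<Rightarrow> 'i \<Rightarrow> complex) \<Rightarrow> 'i \<Rightarrow> 'i list \<Rightarrow> 'i \<Rightarrow> complex" where
  "walk K x [] y = K x y"
| "walk K x (z # zs) y = K x z * walk K z zs y"

fun cyc :: "('i \<Rightarrow> 'i \<Rightarrow> complex) \<Rightarrow> 'i list \<Rightarrow> complex" where
  "cyc K [] = 1"
| "cyc K (x # xs) = walk K x xs x"

lemma walk_snoc: "walk K x (zs @ [z]) y = walk K x zs z * K z y"
  by (induction zs arbitrary: x) auto

lemma cyc_rotate1: "cyc K (rotate1 xs) = cyc K xs"
proof (cases xs)
  case (Cons x ys)
  then show ?thesis by (cases ys) (auto simp: walk_snoc)
qed simp

lemma cyc_rotate: "cyc K (rotate k xs) = cyc K xs"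
  by (induction k) (auto simp: cyc_rotate1)

lemma cmod_walk_le:
  assumes "successively (\<lambda>x y. cmod (K x y) \<le> c) (x # zs @ [y])" "c \<ge> 0"
  shows "cmod (walk K x zs y) \<le> c ^ Suc (length zs)"
  using assms(1)
proof (induction zs arbitrary: x)
  case (Cons z zs)
  then have "cmod (K x z) * cmod (walk K z zs y) \<le> c * c ^ Suc (length zs)"
    using assms(2) by (intro mult_mono) auto
  then show ?case by (simp add: norm_mult)
qed simp

lemma not_successively_decomp:
  "\<not> successively P xs \<Longrightarrow> \<exists>u c d z. xs = u @ c # d # z \<and> \<not> P c d"
proof (induction xs)
  case (Cons x xs)
  then obtain y ys where xs: "xs = y # ys" by (cases xs) auto
  show ?case
  proof (cases "P x y")
    case True
    then obtain u c d z where "xs = u @ c # d # z" "\<not> P c d" using Cons xs by auto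
    then show ?thesis by (intro exI[of _ "x # u"]) auto
  next
    case False
    then show ?thesis using xs by (intro exI[of _ "[]"]) auto
  qed
qed simp

lemma sum_PiE_insert:
  fixes F :: "('a \<Rightarrow> 'i) \<Rightarrow> 'c::comm_monoid_add"
  assumes "a \<notin> A"
  shows "(\<Sum>x\<in>insert a A \<rightarrow>\<^sub>E I. F x) = (\<Sum>y\<in>A \<rightarrow>\<^sub>E I. \<Sum>i\<in>I. F (y(a := i)))"
proof -
  have "(\<Sum>x\<in>insert a A \<rightarrow>\<^sub>E I. F x) = (\<Sum>(y, i)\<in>(A \<rightarrow>\<^sub>E I) \<times> I. F (y(a := i)))"
  proof (rule sum.reindex_bij_witness[of _ "\<lambda>(y, i). y(a := i)" "\<lambda>x. (x(a := undefined), x a)"], goal_cases)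
    case (2 x)
    then show ?case using assms by (auto simp: PiE_def Pi_def extensional_def)
  next
    case (3 z)
    then obtain y i where z: "z = (y, i)" "y \<in> A \<rightarrow>\<^sub>E I" by auto
    then have "y a = undefined" using assms by (auto simp: PiE_def extensional_def)
    then show ?case using z by auto
  next
    case (4 z)
    then show ?case by (auto simp: PiE_def Pi_def extensional_def)
  qed (auto simp: fun_upd_idem)
  then show ?thesis by (simp add: sum.cartesian_product)
qed

text \<open>The error constant of the induction on \<open>length w + card (set w) + card (set w - L)\<close> in
  \<open>norm_sum_approx\<close>.\<close>

fun err_const :: "nat \<Rightarrow> real" where
  "err_const 0 = 1"
| "err_const (Suc N) = err_const N + real (Suc N) * (1 + 2 * err_const N) + 1"

lemma err_const_pos: "err_const N \<ge> 1"
  by (induction N) auto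

text \<open>An abstract Gram kernel of \<open>m * n\<close> unit vectors in dimension
  \<open>n\<close> that form a tight frame with frame constant \<open>m\<close>:
  \<open>reproducing\<close> says that the kernel squared is \<open>m\<close> times itself, and
  \<open>offdiag\<close> carries the unbiasedness.\<close>

locale tight_kernel =
  fixes K :: "'i \<Rightarrow> 'i \<Rightarrow> complex" and I :: "'i set" and m n :: nat
  assumes finite_I: "finite I" and card_I: "card I = m * n"
    and m_pos: "m > 0" and n_pos: "n > 0"
    and diag: "x \<in> I \<Longrightarrow> K x x = 1"
    and reproducing: "x \<in> I \<Longrightarrow> z \<in> I \<Longrightarrow> (\<Sum>y\<in>I. K x y * K y z) = of_nat m * K x z"
    and offdiag: "x \<in> I \<Longrightarrow> y \<in> I \<Longrightarrow> x \<noteq> y \<Longrightarrow> cmod (K x y) \<le> 1 / sqrt (real n)"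
begin

text \<open>The set \<open>L\<close> of letters required to receive distinct values interpolates between the
  unrestricted sum and the injective one, to which the off-diagonal bound applies.\<close>

definition cyc_sum :: "'a list \<Rightarrow> 'a set \<Rightarrow> complex" where
  "cyc_sum w L = (\<Sum>x\<in>set w \<rightarrow>\<^sub>E I. of_bool (inj_on x L) * cyc K (map x w))"

lemma cyc_sum_rotate: "cyc_sum (rotate k w) L = cyc_sum w L"
  unfolding cyc_sum_def by (simp add: rotate_map[symmetric] cyc_rotate)

text \<open>If the values on \<open>L\<close> are distinct, the value of \<open>a\<close> either
  differs from all of them or equals the value of exactly one \<open>b\<close> in \<open>L\<close>;
  in the second case \<open>a\<close> can be renamed to \<open>b\<close>.\<close>

lemma cyc_sum_merge:
  assumes "a \<in> set w" "a \<notin> L" "L \<subseteq> set w"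
  shows "cyc_sum w L = cyc_sum w (insert a L) + (\<Sum>b\<in>L. cyc_sum (map (id(a := b)) w) L)"
proof -
  have finL: "finite L" using assms(3) finite_subset by blast
  have split: "of_bool (inj_on x L) = (of_bool (inj_on x (insert a L)) :: complex)
      + (\<Sum>b\<in>L. of_bool (inj_on x L \<and> x a = x b))" for x :: "'a \<Rightarrow> 'i"
  proof (cases "inj_on x L \<and> x a \<in> x ` L")
    case True
    then obtain b where b: "b \<in> L" "x a = x b" by auto
    have "(\<Sum>c\<in>L. of_bool (inj_on x L \<and> x a = x c)) = (\<Sum>c\<in>L. if c = b then 1 else (0::complex))"
      using True b by (intro sum.cong) (auto dest: inj_onD)
    also have "\<dots> = 1" using finL b by simp
    finally show ?thesis using True assms(2) by auto
  next
    case False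
    then have "(\<Sum>c\<in>L. of_bool (inj_on x L \<and> x a = x c)) = (0::complex)" by (intro sum.neutral) auto
    then show ?thesis using False assms(2) by auto
  qed
  \<comment> \<open>The constraint determines the coordinate \<open>a\<close> from \<open>b\<close>,
    so summing it out leaves the renamed word on one letter fewer.\<close>
  have part: "(\<Sum>x\<in>set w \<rightarrow>\<^sub>E I. of_bool (inj_on x L \<and> x a = x b) * cyc K (map x w))
      = cyc_sum (map (id(a := b)) w) L" if b: "b \<in> L" for b
  proof -
    have ab: "a \<noteq> b" "b \<in> set w" using b assms by auto
    have S: "set (map (id(a := b)) w) = set w - {a}" using ab assms(1) by auto
    have ins: "set w = insert a (set w - {a})" using assms(1) by auto
    have "(\<Sum>x\<in>set w \<rightarrow>\<^sub>E I. of_bool (inj_on x L \<and> x a = x b) * cyc K (map x w))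
      = (\<Sum>y\<in>(set w - {a}) \<rightarrow>\<^sub>E I. \<Sum>i\<in>I. of_bool (inj_on (y(a := i)) L \<and> (y(a := i)) a = (y(a := i)) b)
            * cyc K (map (y(a := i)) w))"
      by (subst ins, rule sum_PiE_insert) simp
    also have "\<dots> = (\<Sum>y\<in>(set w - {a}) \<rightarrow>\<^sub>E I. \<Sum>i\<in>I. if i = y b then of_bool (inj_on y L)
            * cyc K (map (y(a := y b)) w) else 0)"
    proof (intro sum.cong, goal_cases)
      case (3 y i)
      have "inj_on (y(a := i)) L = inj_on y L" using assms(2) by (intro inj_on_cong) auto
      then show ?case using ab by auto
    qed auto
    also have "\<dots> = (\<Sum>y\<in>(set w - {a}) \<rightarrow>\<^sub>E I. of_bool (inj_on y L) * cyc K (map (y(a := y b)) w))"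
      using finite_I ab by (intro sum.cong) (auto simp: PiE_def Pi_def)
    also have "\<dots> = (\<Sum>y\<in>(set w - {a}) \<rightarrow>\<^sub>E I. of_bool (inj_on y L) * cyc K (map y (map (id(a := b)) w)))"
    proof (intro sum.cong refl, goal_cases)
      case (1 y)
      have "map (y(a := y b)) w = map y (map (id(a := b)) w)" by auto
      then show ?case by (simp only:)
    qed
    finally show ?thesis unfolding cyc_sum_def S .
  qed
  have "cyc_sum w L = (\<Sum>x\<in>set w \<rightarrow>\<^sub>E I. of_bool (inj_on x (insert a L)) * cyc K (map x w)
      + (\<Sum>b\<in>L. of_bool (inj_on x L \<and> x a = x b) * cyc K (map x w)))"
    unfolding cyc_sum_def by (subst split) (simp add: ring_distribs sum_distrib_right)
  also have "\<dots> = cyc_sum w (insert a L)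
      + (\<Sum>b\<in>L. \<Sum>x\<in>set w \<rightarrow>\<^sub>E I. of_bool (inj_on x L \<and> x a = x b) * cyc K (map x w))"
    unfolding cyc_sum_def sum.distrib by (subst (2) sum.swap) (rule refl)
  also have "\<dots> = cyc_sum w (insert a L) + (\<Sum>b\<in>L. cyc_sum (map (id(a := b)) w) L)"
    using part by simp
  finally show ?thesis .
qed

text \<open>The letter \<open>a\<close> occurs in just two kernel factors, next to the last and
  first letters of \<open>v\<close>, and \<open>L\<close> does not constrain it. Summing over its
  value by \<open>reproducing\<close> joins these neighbours directly at the price of a factor
  \<open>m\<close>.\<close>

lemma cyc_sum_singleton:
  assumes "a \<notin> set v" "v \<noteq> []" "L \<subseteq> set v"
  shows "cyc_sum (a # v) L = of_nat m * cyc_sum v L"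
proof -
  have "cyc_sum (a # v) L = (\<Sum>y\<in>set v \<rightarrow>\<^sub>E I. \<Sum>i\<in>I.
      of_bool (inj_on (y(a := i)) L) * cyc K (map (y(a := i)) (a # v)))"
    unfolding cyc_sum_def list.set(2) by (rule sum_PiE_insert[OF assms(1)])
  also have "\<dots> = (\<Sum>y\<in>set v \<rightarrow>\<^sub>E I. of_nat m * (of_bool (inj_on y L) * cyc K (map y v)))"
  proof (intro sum.cong refl, goal_cases)
    case (1 y)
    obtain b u where v: "v = b # u" using assms(2) by (cases v) auto
    have inj: "inj_on (y(a := i)) L = inj_on y L" for i using assms by (intro inj_on_cong) auto
    have mp: "map (y(a := i)) v = map y v" for i using assms(1) by auto
    have "(\<Sum>i\<in>I. cyc K (i # map y v)) = of_nat m * cyc K (map y v)"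
    proof (cases u rule: rev_cases)
      case Nil
      have "(\<Sum>i\<in>I. K i (y b) * K (y b) i) = (\<Sum>i\<in>I. K (y b) i * K i (y b))"
        by (simp add: mult.commute)
      then show ?thesis using v Nil reproducing[of "y b" "y b"] 1 by auto
    next
      case (snoc u' c)
      have "(\<Sum>i\<in>I. cyc K (i # map y v)) = (\<Sum>i\<in>I. walk K (y b) (map y u') (y c) * (K (y c) i * K i (y b)))"
        using v snoc by (intro sum.cong) (auto simp: walk_snoc)
      also have "\<dots> = walk K (y b) (map y u') (y c) * (of_nat m * K (y c) (y b))"
        using v snoc 1 reproducing[of "y c" "y b"] by (auto simp flip: sum_distrib_left)
      finally show ?thesis using v snoc by (simp add: walk_snoc)
    qed
    then show ?case by (simp add: inj mp del: cyc.simps map_fun_upd flip: sum_distrib_left)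
  qed
  also have "\<dots> = of_nat m * cyc_sum v L" unfolding cyc_sum_def sum_distrib_left ..
  finally show ?thesis .
qed

lemma cyc_sum_dup: "cyc_sum (a # a # v) L = cyc_sum (a # v) L"
proof -
  have "K (x a) (x a) = 1" if "x \<in> set (a # v) \<rightarrow>\<^sub>E I" for x
    using PiE_mem[OF that, of a] by (simp add: diag)
  then show ?thesis unfolding cyc_sum_def by (intro sum.cong) auto
qed

lemma cyc_sum_one: "cyc_sum [a] {a} = of_nat (m * n)"
proof -
  have "cyc_sum [a] {a} = (\<Sum>x\<in>{a} \<rightarrow>\<^sub>E I. 1)"
    unfolding cyc_sum_def using PiE_mem[of _ "{a}" "\<lambda>_. I" a] by (intro sum.cong) (auto simp: diag)
  also have "\<dots> = of_nat (m * n)" by (simp add: card_PiE card_I)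
  finally show ?thesis .
qed

text \<open>For an injective assignment every cyclic step is off-diagonal, and each letter occurs at
  least twice, so with \<open>k\<close> letters the product is at most \<open>n\<close> to the power
  \<open>-k\<close>. There are at most \<open>(m * n) ^ k\<close> assignments.\<close>

lemma irreducible_bound:
  assumes w: "w \<noteq> []"
    and red: "\<And>k a v. rotate k w \<noteq> a # a # v" "\<And>k a v. rotate k w = a # v \<Longrightarrow> a \<in> set v"
  shows "cmod (cyc_sum w (set w)) \<le> real m ^ card (set w)"
proof -
  have "count_list w a \<ge> 2" if a: "a \<in> set w" for a
  proof -
    obtain u v where uv: "w = u @ a # v" using a by (meson split_list)
    have "a \<in> set (v @ u)" using red(2)[of "length u" a "v @ u"] rotate_split[of u "a # v"] uv by simp
    then have "count_list u a > 0 \<or> count_list v a > 0" by (auto simp: count_list_0_iff neq0_conv[symmetric] simp del: neq0_conv)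
    then show ?thesis using uv by auto
  qed
  then have "(\<Sum>a\<in>set w. 2) \<le> (\<Sum>a\<in>set w. count_list w a)" by (intro sum_mono) auto
  then have len: "2 * card (set w) \<le> length w" by (simp add: sum_count_set)
  obtain a v where av: "w = a # v" using w by (cases w) auto
  \<comment> \<open>Appending the first letter at the end turns cyclic adjacency into ordinary
    adjacency.\<close>
  have succ: "successively (\<noteq>) (a # v @ [a])"
  proof (rule ccontr)
    assume "\<not> ?thesis"
    then obtain u c z where e: "a # v @ [a] = u @ c # c # z"
      using not_successively_decomp by blast
    show False
    proof (cases z rule: rev_cases)
      \<comment> \<open>The equal neighbours meet at the wrap-around; a rotation brings them to the
        front, unless the word is a single letter.\<close>
      case Nil
      then have wu: "w = u @ [a]" using e av by auto
      show False
      proof (cases u)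
        case Nil
        then show False using red(2)[of 0 a "[]"] wu by simp
      next
        case (Cons a' u')
        then have "rotate (length u) w = a # a # u'" using wu av rotate_split[of u "[a]"] by simp
        then show False using red(1) by blast
      qed
    next
      case (snoc z' b)
      then have "w = u @ c # c # z'" using e av by auto
      then have "rotate (length u) w = c # c # z' @ u" using rotate_split[of u "c # c # z'"] by simp
      then show False using red(1) by blast
    qed
  qed
  let ?c = "1 / sqrt (real n)"
  have c: "0 \<le> ?c" "?c \<le> 1" using n_pos by auto
  have summand: "cmod (of_bool (inj_on x (set w)) * cyc K (map x w)) \<le> (1 / real n) ^ card (set w)"
    if x: "x \<in> set w \<rightarrow>\<^sub>E I" for x
  proof (cases "inj_on x (set w)")
    case True
    have "successively (\<lambda>a b. cmod (K (x a) (x b)) \<le> ?c) (a # v @ [a])"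
    proof (rule successively_mono[OF succ])
      fix b d assume "b \<in> set (a # v @ [a])" "d \<in> set (a # v @ [a])" "b \<noteq> d"
      then have bd: "b \<in> set w" "d \<in> set w" "b \<noteq> d" using av by auto
      then have "x b \<noteq> x d" using True by (auto dest: inj_onD)
      then show "cmod (K (x b) (x d)) \<le> ?c" using offdiag bd x by auto
    qed
    then have "successively (\<lambda>a b. cmod (K a b) \<le> ?c) (map x (a # v @ [a]))"
      by (simp only: successively_map)
    then have "cmod (walk K (x a) (map x v) (x a)) \<le> ?c ^ Suc (length (map x v))"
      using c by (intro cmod_walk_le) auto
    then have "cmod (cyc K (map x w)) \<le> ?c ^ length w" using av by simp
    also have "\<dots> \<le> ?c ^ (2 * card (set w))" using c len by (intro power_decreasing) auto
    also have "\<dots> = (1 / real n) ^ card (set w)" using n_pos by (simp add: power_mult power_divide)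
    finally show ?thesis using True by simp
  qed simp
  have "cmod (cyc_sum w (set w)) \<le> (\<Sum>x\<in>set w \<rightarrow>\<^sub>E I. (1 / real n) ^ card (set w))"
    unfolding cyc_sum_def by (rule sum_norm_le) (rule summand)
  also have "\<dots> = (real m * real n) ^ card (set w) * (1 / real n) ^ card (set w)"
    by (simp add: card_PiE card_I)
  also have "\<dots> = real m ^ card (set w)"
    using n_pos by (simp add: power_mult_distrib power_divide)
  finally show ?thesis .
qed

section \<open>Approximation by the noncrossing indicator\<close>

text \<open>The denominator gives a one-letter word the value 1 and absorbs the factor
  \<open>m\<close> from \<open>cyc_sum_singleton\<close>.\<close>

definition norm_sum :: "'a list \<Rightarrow> 'a set \<Rightarrow> complex" where
  "norm_sum w L = cyc_sum w L / (of_nat n * of_nat m ^ card (set w))"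

lemma card_merge:
  assumes "a \<in> set w" "b \<in> set w" "a \<noteq> b"
  shows "set (map (id(a := b)) w) = set w - {a}" "card (set w) = Suc (card (set (map (id(a := b)) w)))"
proof -
  show 1: "set (map (id(a := b)) w) = set w - {a}" using assms by auto
  show "card (set w) = Suc (card (set (map (id(a := b)) w)))"
    unfolding 1 using assms(1) by (metis card_Suc_Diff1 List.finite_set)
qed

text \<open>A renamed word has one letter fewer, so one factor \<open>m\<close> of the denominator
  is left over.\<close>

lemma norm_sum_merge:
  assumes "a \<in> set w" "a \<notin> L" "L \<subseteq> set w"
  shows "norm_sum w L = norm_sum w (insert a L) + (\<Sum>b\<in>L. norm_sum (map (id(a := b)) w) L) / of_nat m"
proof -
  have "cyc_sum (map (id(a := b)) w) L / (of_nat n * of_nat m ^ card (set w))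
      = norm_sum (map (id(a := b)) w) L / of_nat m" if "b \<in> L" for b
  proof -
    have "card (set w) = Suc (card (set (map (id(a := b)) w)))"
      by (rule card_merge) (use assms that in auto)
    then show ?thesis unfolding norm_sum_def by (simp only: power_Suc divide_divide_eq_left mult_ac)
  qed
  then show ?thesis unfolding norm_sum_def[of w]
    by (simp add: cyc_sum_merge[OF assms] add_divide_distrib sum_divide_distrib)
qed

text \<open>Each summand is near 0 or 1, with error at most \<open>2 * C\<close> because
  \<open>1 / m + 1 / n \<le> 2\<close>; the prefactor \<open>1 / m\<close> alone then makes the sum
  small.\<close>

lemma merge_bound:
  assumes "finite L" "card L \<le> N" "C \<ge> 0"
    and "\<And>b. b \<in> L \<Longrightarrow> cmod (f b - of_bool (P b)) \<le> C * (1 / real m + 1 / real n)"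
  shows "cmod ((\<Sum>b\<in>L. f b) / of_nat m) \<le> real N * (1 + 2 * C) * (1 / real m + 1 / real n)"
proof -
  have "1 / real m \<le> 1" "1 / real n \<le> 1" using m_pos n_pos by auto
  then have mn: "1 / real m + 1 / real n \<le> 2" "0 \<le> 1 / real m" "0 \<le> 1 / real n" by auto
  have "cmod (f b) \<le> 1 + 2 * C" if "b \<in> L" for b
  proof -
    have "cmod (f b) \<le> cmod (f b - of_bool (P b)) + cmod (of_bool (P b))"
      by (metis diff_add_cancel norm_triangle_ineq)
    also have "\<dots> \<le> C * (1 / real m + 1 / real n) + 1" using assms(4)[OF that] by (intro add_mono) auto
    also have "\<dots> \<le> C * 2 + 1" using mn assms(3) by (intro add_mono mult_left_mono) auto
    finally show ?thesis by simp
  qed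
  then have "cmod (\<Sum>b\<in>L. f b) \<le> (\<Sum>b\<in>L. 1 + 2 * C)" by (rule sum_norm_le)
  also have "\<dots> = real (card L) * (1 + 2 * C)" by simp
  also have "\<dots> \<le> real N * (1 + 2 * C)" using assms by (intro mult_right_mono) auto
  finally have "cmod ((\<Sum>b\<in>L. f b) / of_nat m) \<le> real N * (1 + 2 * C) * (1 / real m)"
    using m_pos by (simp add: norm_divide divide_right_mono)
  also have "\<dots> \<le> real N * (1 + 2 * C) * (1 / real m + 1 / real n)"
    using mn assms by (intro mult_left_mono) auto
  finally show ?thesis .
qed

text \<open>While \<open>L\<close> misses a letter, adding it to \<open>L\<close> costs merge terms.
  Once \<open>L\<close> is full, the word is shortened by deleting a duplicate or summing out a
  single letter, neither of which affects crossings. An irreducible word is crossing, and its sum is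
  at most \<open>1 / n\<close>.\<close>

lemma norm_sum_approx:
  fixes w :: "'a list"
  assumes "w \<noteq> []" "L \<subseteq> set w" "length w + card (set w) + card (set w - L) \<le> N"
  shows "cmod (norm_sum w L - of_bool (\<not> crossing w)) \<le> err_const N * (1 / real m + 1 / real n)"
  using assms
proof (induction N arbitrary: w L)
  case 0
  then show ?case by simp
next
  case (Suc N)
  define \<delta> where "\<delta> = 1 / real m + 1 / real n"
  define C where "C = err_const N"
  have C: "C \<ge> 1" by (simp add: C_def err_const_pos)
  have \<delta>: "\<delta> \<ge> 0" "1 / real n \<le> \<delta>" by (simp_all add: \<delta>_def)
  have IH: "cmod (norm_sum v M - of_bool (\<not> crossing v)) \<le> C * \<delta>"
    if "v \<noteq> []" "M \<subseteq> set v" "length v + card (set v) + card (set v - M) \<le> N" for v :: "'a list" and M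
    using Suc.IH[OF that] by (simp add: C_def \<delta>_def)
  \<comment> \<open>Merging lowers both the number of letters and the number outside
    \<open>M\<close>, so words of measure \<open>Suc (Suc N)\<close> are still within reach of the
    induction hypothesis. The single-letter case below uses this slack.\<close>
  have sumbound: "cmod ((\<Sum>b\<in>M. norm_sum (map (id(a := b)) v) M) / of_nat m) \<le> real (Suc N) * (1 + 2 * C) * \<delta>"
    if a: "a \<in> set v" "a \<notin> M" "M \<subseteq> set v"
      and le: "length v + card (set v) + card (set v - M) \<le> Suc (Suc N)" "card (set v) \<le> Suc N"
    for v :: "'a list" and a M
    unfolding \<delta>_def
  proof (rule merge_bound)
    show "finite M" using a(3) finite_subset by blast
    have "card M \<le> card (set v)" using a(3) by (simp add: card_mono)
    then show "card M \<le> Suc N" using le by simp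
    show "C \<ge> 0" using C by simp
    fix b assume b: "b \<in> M"
    let ?u = "map (id(a := b)) v"
    have S: "set ?u = set v - {a}" "card (set v) = Suc (card (set ?u))"
      by (rule card_merge; use a b in auto)+
    have "set v - M = insert a (set ?u - M)" "a \<notin> set ?u - M" using S a by auto
    then have "card (set v - M) = Suc (card (set ?u - M))" by (metis card_insert_disjoint finite_Diff List.finite_set)
    then have "length ?u + card (set ?u) + card (set ?u - M) \<le> N" using le S by simp
    moreover have "?u \<noteq> []" "M \<subseteq> set ?u" using a S by auto
    ultimately show "cmod (norm_sum ?u M - of_bool (\<not> crossing ?u)) \<le> C * (1 / real m + 1 / real n)"
      using IH unfolding \<delta>_def by blast
  qed
  have split: "cmod (x - e) \<le> err_const (Suc N) * \<delta>"
    if "x = y + s" "cmod (y - e) \<le> C * \<delta>" "cmod s \<le> real (Suc N) * (1 + 2 * C) * \<delta>" for x y e s :: complex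
  proof -
    have "cmod (x - e) = cmod ((y - e) + s)" using that(1) by (simp add: algebra_simps)
    also have "\<dots> \<le> C * \<delta> + real (Suc N) * (1 + 2 * C) * \<delta>"
      using that(2,3) by (intro norm_triangle_le add_mono)
    also have "\<dots> \<le> err_const (Suc N) * \<delta>" using \<delta> by (simp add: C_def algebra_simps)
    finally show ?thesis .
  qed
  have zero: "0 \<le> real (Suc N) * (1 + 2 * C) * \<delta>" using C \<delta> by simp
  show ?case
  proof (cases "L = set w")
    case False
    then obtain a where a: "a \<in> set w" "a \<notin> L" using Suc.prems(2) by auto
    have dec: "card (set w - L) = Suc (card (set w - insert a L))"
    proof -
      have "set w - L = insert a (set w - insert a L)" using a by auto
      then show ?thesis by (metis DiffD2 card_insert_disjoint finite_Diff insertI1 List.finite_set)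
    qed
    have le': "length w + card (set w) + card (set w - insert a L) \<le> N"
      using Suc.prems(3) dec by linarith
    have le2: "length w + card (set w) + card (set w - L) \<le> Suc (Suc N)" "card (set w) \<le> Suc N"
      using Suc.prems(3) by linarith+
    have "cmod (norm_sum w L - of_bool (\<not> crossing w)) \<le> err_const (Suc N) * \<delta>"
    proof (rule split)
      show "norm_sum w L = norm_sum w (insert a L) + (\<Sum>b\<in>L. norm_sum (map (id(a := b)) w) L) / of_nat m"
        by (rule norm_sum_merge[OF a Suc.prems(2)])
      show "cmod (norm_sum w (insert a L) - of_bool (\<not> crossing w)) \<le> C * \<delta>"
        by (rule IH[OF Suc.prems(1) _ le']) (use Suc.prems(2) a(1) in auto)
      show "cmod ((\<Sum>b\<in>L. norm_sum (map (id(a := b)) w) L) / of_nat m) \<le> real (Suc N) * (1 + 2 * C) * \<delta>"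
        by (rule sumbound[OF a Suc.prems(2) le2])
    qed
    then show ?thesis by (simp only: \<delta>_def)
  next
    case L: True
    have le: "length w + card (set w) \<le> Suc N" using Suc.prems L by simp
    consider (dup) k a v where "rotate k w = a # a # v"
      | (single) k a v where "rotate k w = a # v" "a \<notin> set v"
      | (irred) "\<And>k a v. rotate k w \<noteq> a # a # v" "\<And>k a v. rotate k w = a # v \<Longrightarrow> a \<in> set v"
      by blast
    then have "cmod (norm_sum w L - of_bool (\<not> crossing w)) \<le> err_const (Suc N) * \<delta>"
    proof cases
      case dup
      have S: "set w = set (a # v)" "length w = Suc (length (a # v))"
        using arg_cong[OF dup, of set] arg_cong[OF dup, of length] by auto
      have "cyc_sum w L = cyc_sum (a # v) L" using cyc_sum_rotate[of k w L] dup cyc_sum_dup by metis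
      then have 1: "norm_sum w L = norm_sum (a # v) L + 0" by (simp add: norm_sum_def S)
      have 2: "crossing w = crossing (a # v)" using crossing_rotate[of k w] dup crossing_dup by metis
      have "cmod (norm_sum (a # v) L - of_bool (\<not> crossing w)) \<le> C * \<delta>"
        unfolding 2 by (rule IH) (use L S le in auto)
      then show ?thesis using split[OF 1] zero by simp
    next
      case single
      have S: "set w = insert a (set v)" "length w = Suc (length v)"
        using arg_cong[OF single(1), of set] arg_cong[OF single(1), of length] by auto
      have rot: "norm_sum w L = norm_sum (a # v) (insert a (set v))"
        using cyc_sum_rotate[of k w L] single L by (simp add: norm_sum_def S)
      have 2: "crossing w = crossing v"
        using crossing_rotate[of k w] single crossing_singleton by metis
      show ?thesis
      proof (cases "v = []")
        case True
        have "norm_sum w L = 1" using rot True m_pos n_pos by (simp add: norm_sum_def cyc_sum_one)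
        moreover have "\<not> crossing w" using 2 True by (simp add: crossing_def)
        ultimately show ?thesis using \<delta>(1) err_const_pos[of "Suc N"] by simp
      next
        case False
        \<comment> \<open>Injectivity at \<open>a\<close> blocks summing it out. So the constraint
          is dropped first, and the surplus merge terms are subtracted as an error.\<close>
        have "norm_sum (a # v) (set v) = norm_sum v (set v)"
          using single(2) False m_pos by (simp add: norm_sum_def cyc_sum_singleton)
        then have "norm_sum w L = norm_sum v (set v)
            + - ((\<Sum>b\<in>set v. norm_sum (map (id(a := b)) (a # v)) (set v)) / of_nat m)"
          using norm_sum_merge[of a "a # v" "set v"] single(2) rot subset_insertI[of "set v" a]
          by (simp add: algebra_simps)
        moreover have "cmod (norm_sum v (set v) - of_bool (\<not> crossing w)) \<le> C * \<delta>"
          unfolding 2 by (rule IH) (use False S le single in auto)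
        moreover have "cmod (- ((\<Sum>b\<in>set v. norm_sum (map (id(a := b)) (a # v)) (set v)) / of_nat m))
            \<le> real (Suc N) * (1 + 2 * C) * \<delta>"
          unfolding norm_minus_cancel by (rule sumbound) (use single S le in \<open>auto simp: insert_Diff_if\<close>)
        ultimately show ?thesis by (rule split)
      qed
    next
      case irred
      have cr: "crossing w" using noncrossing_reducible[of w] irred Suc.prems(1) by blast
      have "cmod (norm_sum w L) = cmod (cyc_sum w (set w)) / (real n * real m ^ card (set w))"
        unfolding norm_sum_def L by (simp add: norm_divide norm_mult norm_power)
      also have "\<dots> \<le> real m ^ card (set w) / (real n * real m ^ card (set w))"
        using irreducible_bound[OF Suc.prems(1) irred] by (intro divide_right_mono) auto
      also have "\<dots> = 1 / real n" using m_pos by simp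
      also have "\<dots> \<le> 1 * \<delta>" using \<delta> by simp
      also have "\<dots> \<le> err_const (Suc N) * \<delta>" using \<delta> err_const_pos[of "Suc N"] by (intro mult_right_mono) auto
      finally show ?thesis using cr by simp
    qed
    then show ?thesis by (simp only: \<delta>_def)
  qed
qed

end

section \<open>Gram matrices of mutually unbiased bases\<close>

text \<open>Orthonormality says \<open>U * V = 1\<close> for square matrices, so
  \<open>V * U = 1\<close> as well, and the latter is the resolution of the identity behind
  Parseval's formula.\<close>

lemma orthonormal_basis_complete:
  assumes "orthonormal_basis n b"
  shows "(\<Sum>k<n. cinner n u (b k) * cinner n (b k) v) = cinner n u v"
proof -
  define U where "U = mat n n (\<lambda>(k, j). b k j)"
  define V where "V = mat n n (\<lambda>(j, k). cnj (b k j))"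
  have car: "U \<in> carrier_mat n n" "V \<in> carrier_mat n n" by (auto simp: U_def V_def)
  have "U * V = 1\<^sub>m n"
  proof (rule eq_matI)
    fix i j assume "i < dim_row (1\<^sub>m n :: complex mat)" "j < dim_col (1\<^sub>m n :: complex mat)"
    then have ij: "i < n" "j < n" by auto
    have "(U * V) $$ (i, j) = cinner n (b i) (b j)"
      using ij by (simp add: U_def V_def scalar_prod_def cinner_def atLeast0LessThan)
    then show "(U * V) $$ (i, j) = 1\<^sub>m n $$ (i, j)"
      using assms ij by (simp add: orthonormal_basis_def)
  qed (auto simp: U_def V_def)
  then have VU: "V * U = 1\<^sub>m n" using mat_mult_left_right_inverse car by blast
  have delta: "(\<Sum>k<n. cnj (b k i) * b k j) = (if i = j then 1 else 0)" if "i < n" "j < n" for i j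
  proof -
    have "(V * U) $$ (i, j) = (\<Sum>k<n. cnj (b k i) * b k j)"
      using that by (simp add: U_def V_def scalar_prod_def atLeast0LessThan)
    then show ?thesis using VU that by simp
  qed
  have "(\<Sum>k<n. cinner n u (b k) * cinner n (b k) v)
      = (\<Sum>k<n. \<Sum>i<n. \<Sum>j<n. u i * cnj (v j) * (cnj (b k i) * b k j))"
    unfolding cinner_def sum_product by (intro sum.cong) (auto simp: mult_ac)
  also have "\<dots> = (\<Sum>i<n. \<Sum>j<n. \<Sum>k<n. u i * cnj (v j) * (cnj (b k i) * b k j))"
    by (subst sum.swap, rule sum.cong, simp, rule sum.swap)
  also have "\<dots> = (\<Sum>i<n. \<Sum>j<n. if i = j then u i * cnj (v j) else 0)"
    unfolding sum_distrib_left[symmetric] by (intro sum.cong) (auto simp: delta)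
  also have "\<dots> = cinner n u v" by (simp add: cinner_def)
  finally show ?thesis .
qed

definition mub_kernel :: "nat \<Rightarrow> (nat \<Rightarrow> nat \<Rightarrow> nat \<Rightarrow> complex) \<Rightarrow> nat \<times> nat \<Rightarrow> nat \<times> nat \<Rightarrow> complex" where
  "mub_kernel n B x y = cinner n (B (fst x) (snd x)) (B (fst y) (snd y))"

text \<open>Each of the \<open>m\<close> bases reproduces the kernel once by completeness. Distinct
  vectors of the same basis are orthogonal, so \<open>offdiag\<close> needs unbiasedness for
  different bases alone.\<close>

lemma tight_kernel_mub:
  assumes "mutually_unbiased n m B" "m > 0" "n > 0"
  shows "tight_kernel (mub_kernel n B) ({..<m} \<times> {..<n}) m n"
proof
  have ob: "orthonormal_basis n (B i)" if "i < m" for i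
    using assms(1) that by (simp add: mutually_unbiased_def)
  show "finite ({..<m} \<times> {..<n})" "card ({..<m} \<times> {..<n}) = m * n" "m > 0" "n > 0"
    using assms by (auto simp: card_cartesian_product)
  fix x z assume x: "x \<in> {..<m} \<times> {..<n}" and z: "z \<in> {..<m} \<times> {..<n}"
  have "(\<Sum>y\<in>{..<m} \<times> {..<n}. mub_kernel n B x y * mub_kernel n B y z)
      = (\<Sum>i<m. \<Sum>k<n. cinner n (B (fst x) (snd x)) (B i k) * cinner n (B i k) (B (fst z) (snd z)))"
    unfolding mub_kernel_def sum.cartesian_product by (intro sum.cong) auto
  also have "\<dots> = (\<Sum>i<m. mub_kernel n B x z)"
    unfolding mub_kernel_def by (intro sum.cong orthonormal_basis_complete ob) auto
  finally show "(\<Sum>y\<in>{..<m} \<times> {..<n}. mub_kernel n B x y * mub_kernel n B y z) = of_nat m * mub_kernel n B x z"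
    by simp
next
  fix x assume "x \<in> {..<m} \<times> {..<n}"
  then show "mub_kernel n B x x = 1"
    using assms(1) by (auto simp: mutually_unbiased_def orthonormal_basis_def mub_kernel_def)
next
  fix x y assume xy: "x \<in> {..<m} \<times> {..<n}" "y \<in> {..<m} \<times> {..<n}" "x \<noteq> y"
  show "cmod (mub_kernel n B x y) \<le> 1 / sqrt (real n)"
  proof (cases "fst x = fst y")
    case True
    then have "snd x \<noteq> snd y" using xy by (auto simp: prod_eq_iff)
    then have "mub_kernel n B x y = 0"
      using assms(1) xy True by (auto simp: mutually_unbiased_def orthonormal_basis_def mub_kernel_def)
    then show ?thesis by simp
  next
    case False
    then show ?thesis using assms(1) xy by (auto simp: mutually_unbiased_def mub_kernel_def)
  qed
qed

section \<open>Traces of Gram matrix powers as sums over words\<close>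

lemma pow_mat_Suc_left:
  assumes "A \<in> carrier_mat p p"
  shows "A ^\<^sub>m Suc k = A * A ^\<^sub>m k"
proof (induction k)
  case 0
  then show ?case using assms by simp
next
  case (Suc k)
  have "A ^\<^sub>m Suc (Suc k) = (A * A ^\<^sub>m k) * A" using Suc by simp
  also have "\<dots> = A * (A ^\<^sub>m k * A)" using assms by (intro assoc_mult_mat) auto
  finally show ?case by simp
qed

lemma pow_mat_walk:
  assumes "A \<in> carrier_mat p p" "i < p" "j < p"
  shows "(A ^\<^sub>m Suc l) $$ (i, j) = (\<Sum>w\<in>words p l. walk (\<lambda>a b. A $$ (a, b)) i w j)"
  using assms(2)
proof (induction l arbitrary: i)
  case 0
  then show ?case using assms by simp
next
  case (Suc l)
  have car: "A ^\<^sub>m Suc l \<in> carrier_mat p p" using assms(1) by (rule pow_carrier_mat)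
  have "(A ^\<^sub>m Suc (Suc l)) $$ (i, j) = (A * A ^\<^sub>m Suc l) $$ (i, j)"
    by (simp only: pow_mat_Suc_left[OF assms(1), of "Suc l"])
  also have "\<dots> = (\<Sum>a<p. A $$ (i, a) * (A ^\<^sub>m Suc l) $$ (a, j))"
    using assms Suc.prems car
    by (simp add: scalar_prod_def atLeast0LessThan del: pow_mat.simps)
  also have "\<dots> = (\<Sum>a<p. \<Sum>w\<in>words p l. walk (\<lambda>a b. A $$ (a, b)) i (a # w) j)"
    by (intro sum.cong) (auto simp: Suc.IH sum_distrib_left simp del: pow_mat.simps)
  also have "\<dots> = (\<Sum>w\<in>words p (Suc l). walk (\<lambda>a b. A $$ (a, b)) i w j)"
    unfolding sum_words_Suc by (rule sum.swap)
  finally show ?case .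
qed

lemma trace_pow_mat:
  assumes "A \<in> carrier_mat p p"
  shows "mat_trace (A ^\<^sub>m Suc l) = (\<Sum>w\<in>words p (Suc l). cyc (\<lambda>a b. A $$ (a, b)) w)"
proof -
  have "dim_row (A ^\<^sub>m Suc l) = p" using pow_carrier_mat[OF assms, of "Suc l"] by blast
  then have "mat_trace (A ^\<^sub>m Suc l) = (\<Sum>i<p. \<Sum>w\<in>words p l. walk (\<lambda>a b. A $$ (a, b)) i w i)"
    unfolding mat_trace_def by (auto intro!: sum.cong simp: pow_mat_walk[OF assms] simp del: pow_mat.simps)
  then show ?thesis unfolding sum_words_Suc by (subst (asm) sum.swap) simp
qed

lemma walk_map:
  assumes "\<And>a b. a \<in> S \<Longrightarrow> b \<in> S \<Longrightarrow> H a b = K (s a) (s b)" "x \<in> S" "y \<in> S" "set w \<subseteq> S"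
  shows "walk H x w y = walk K (s x) (map s w) (s y)"
  using assms(2,4) by (induction w arbitrary: x) (auto simp: assms(1,3))

lemma trace_gram_pow:
  "mat_trace (gram n B p s ^\<^sub>m Suc l) = (\<Sum>w\<in>words p (Suc l). cyc (mub_kernel n B) (map s w))"
proof -
  have "gram n B p s \<in> carrier_mat p p" by (simp add: gram_def)
  then have "mat_trace (gram n B p s ^\<^sub>m Suc l)
      = (\<Sum>w\<in>words p (Suc l). cyc (\<lambda>a b. gram n B p s $$ (a, b)) w)" by (rule trace_pow_mat)
  also have "\<dots> = (\<Sum>w\<in>words p (Suc l). cyc (mub_kernel n B) (map s w))"
  proof (rule sum.cong, goal_cases)
    case (2 w)
    then obtain a v where w: "w = a # v" "a < p" "set v \<subseteq> {..<p}" by (cases w) (auto simp: words_def)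
    then show ?case
      using walk_map[of "{..<p}" "\<lambda>a b. gram n B p s $$ (a, b)" "mub_kernel n B" s a a v]
      by (simp add: gram_def mub_kernel_def)
  qed simp
  finally show ?thesis .
qed

section \<open>Expectation over uniform random maps\<close>

lemma sum_PiE_marginal:
  fixes F :: "('a \<Rightarrow> 'i) \<Rightarrow> complex"
  assumes "finite D" "A \<inter> D = {}"
  shows "(\<Sum>s\<in>(A \<union> D) \<rightarrow>\<^sub>E I. F (restrict s A)) = of_nat (card I) ^ card D * (\<Sum>x\<in>A \<rightarrow>\<^sub>E I. F x)"
  using assms
proof (induction D rule: finite_induct)
  case empty
  then show ?case by (auto intro!: sum.cong arg_cong[of _ _ F] simp: PiE_restrict)
next
  case (insert d D)
  have d: "d \<notin> A \<union> D" using insert by auto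
  have "(\<Sum>s\<in>(A \<union> insert d D) \<rightarrow>\<^sub>E I. F (restrict s A))
      = (\<Sum>y\<in>(A \<union> D) \<rightarrow>\<^sub>E I. \<Sum>i\<in>I. F (restrict (y(d := i)) A))"
    using sum_PiE_insert[OF d, of "\<lambda>s. F (restrict s A)" I] by simp
  also have "\<dots> = (\<Sum>y\<in>(A \<union> D) \<rightarrow>\<^sub>E I. \<Sum>i\<in>I. F (restrict y A))"
    using insert.prems by (intro sum.cong refl arg_cong[of _ _ F] restrict_ext) auto
  also have "\<dots> = of_nat (card I) * (\<Sum>y\<in>(A \<union> D) \<rightarrow>\<^sub>E I. F (restrict y A))"
    by (simp add: sum_distrib_left)
  also have "(\<Sum>y\<in>(A \<union> D) \<rightarrow>\<^sub>E I. F (restrict y A)) = of_nat (card I) ^ card D * (\<Sum>x\<in>A \<rightarrow>\<^sub>E I. F x)"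
    by (rule insert.IH) (use insert.prems in auto)
  finally show ?case by (simp only: card_insert_disjoint[OF insert.hyps(1,2)] power_Suc mult.assoc)
qed

text \<open>Positions outside \<open>set w\<close> are free and cancel against the normalisation,
  leaving \<open>(m * n) ^ card (set w)\<close> below; \<open>norm_sum\<close> absorbs the powers of
  \<open>m\<close>. The values are independent and may coincide, hence the empty set of distinct
  letters.\<close>

lemma (in tight_kernel) expectation_cyc:
  assumes "w \<in> words p l"
  shows "(\<Sum>s\<in>{..<p} \<rightarrow>\<^sub>E I. cyc K (map s w)) / of_nat (m * n) ^ p
    = of_nat n * (1 / of_nat n) ^ card (set w) * norm_sum w {}"
proof -
  let ?k = "card (set w)"
  have sub: "set w \<subseteq> {..<p}" using assms by (simp add: words_def)
  have k: "?k \<le> p" using card_mono[OF _ sub] by simp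
  have un: "{..<p} = set w \<union> ({..<p} - set w)" using sub by auto
  have "(\<Sum>s\<in>{..<p} \<rightarrow>\<^sub>E I. cyc K (map s w)) = (\<Sum>s\<in>{..<p} \<rightarrow>\<^sub>E I. cyc K (map (restrict s (set w)) w))"
    by (intro sum.cong refl arg_cong[of _ _ "cyc K"]) auto
  also have "\<dots> = of_nat (card I) ^ card ({..<p} - set w) * (\<Sum>x\<in>set w \<rightarrow>\<^sub>E I. cyc K (map x w))"
    by (subst un, rule sum_PiE_marginal) auto
  also have "\<dots> = of_nat (m * n) ^ (p - ?k) * cyc_sum w {}"
    using sub by (simp add: card_I card_Diff_subset cyc_sum_def)
  finally have eq: "(\<Sum>s\<in>{..<p} \<rightarrow>\<^sub>E I. cyc K (map s w)) = of_nat (m * n) ^ (p - ?k) * cyc_sum w {}" .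
  have "(of_nat (m * n) ^ p :: complex) = of_nat (m * n) ^ (p - ?k) * of_nat (m * n) ^ ?k"
    using k by (simp flip: power_add)
  then have "(\<Sum>s\<in>{..<p} \<rightarrow>\<^sub>E I. cyc K (map s w)) / of_nat (m * n) ^ p = cyc_sum w {} / of_nat (m * n) ^ ?k"
    using m_pos n_pos unfolding eq by simp
  also have "\<dots> = of_nat n * (1 / of_nat n) ^ ?k * norm_sum w {}"
    using m_pos n_pos by (simp add: norm_sum_def power_mult_distrib power_divide field_simps)
  finally show ?thesis .
qed

lemma expect_A_eq:
  assumes "mutually_unbiased n m B" "m > 0" "n > 0" "p > 0"
  shows "expect_A (Suc l) m n B p = of_real (real n / real p) * (\<Sum>w\<in>words p (Suc l).
     of_real ((1 / real n) ^ card (set w)) * tight_kernel.norm_sum (mub_kernel n B) ({..<m} \<times> {..<n}) m n w {})"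
proof -
  interpret tight_kernel "mub_kernel n B" "{..<m} \<times> {..<n}" m n
    using tight_kernel_mub assms by blast
  have cardO: "card (Omega m n p) = (m * n) ^ p"
    by (simp add: Omega_def card_PiE card_cartesian_product)
  have "expect_A (Suc l) m n B p
      = (\<Sum>s\<in>Omega m n p. \<Sum>w\<in>words p (Suc l). cyc (mub_kernel n B) (map s w)) / of_nat p / of_nat (m * n) ^ p"
    unfolding expect_A_def A_l_def trace_gram_pow cardO by (simp add: sum_divide_distrib)
  also have "\<dots> = (\<Sum>w\<in>words p (Suc l). \<Sum>s\<in>Omega m n p. cyc (mub_kernel n B) (map s w)) / of_nat (m * n) ^ p / of_nat p"
    by (subst sum.swap) simp
  also have "\<dots> = (\<Sum>w\<in>words p (Suc l). (\<Sum>s\<in>Omega m n p. cyc (mub_kernel n B) (map s w)) / of_nat (m * n) ^ p) / of_nat p"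
    by (simp only: sum_divide_distrib)
  also have "\<dots> = (\<Sum>w\<in>words p (Suc l). of_nat n * (1 / of_nat n) ^ card (set w) * norm_sum w {}) / of_nat p"
    unfolding Omega_def by (intro arg_cong2[of _ _ _ _ "(/)"] sum.cong refl expectation_cyc)
  also have "\<dots> = of_real (real n / real p) * (\<Sum>w\<in>words p (Suc l).
     of_real ((1 / real n) ^ card (set w)) * norm_sum w {})"
    by (simp add: sum_distrib_left sum_divide_distrib mult_ac)
  finally show ?thesis .
qed

section \<open>Moment asymptotics with error term\<close>

theorem theorem2:
  fixes l :: nat
  assumes "l > 0"
  shows "\<exists>C. \<forall>n m p (B :: nat \<Rightarrow> nat \<Rightarrow> nat \<Rightarrow> complex).
           n \<ge> 2 \<longrightarrow> m \<ge> 2 \<longrightarrow> real m \<ge> sqrt (real n) \<longrightarrow>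
           mutually_unbiased n m B \<longrightarrow> p > 0 \<longrightarrow> p < n \<longrightarrow>
           cmod (expect_A l m n B p -
                 complex_of_real (\<Sum>i<l. (real p / real n) ^ i / real (i + 1)
                                     * real (l choose i) * real ((l - 1) choose i)))
             \<le> C * (1 / real m + 1 / real n)"
proof -
  \<comment> \<open>\<open>C1\<close> bounds the error from replacing cyclic sums by the noncrossing
    indicator: \<open>fact l\<close> comes from the total weight of words, and \<open>3 * l\<close>
    bounds the induction measure, whose three terms are each at most \<open>l\<close>.
    \<open>C2\<close> bounds the error from replacing falling factorials by powers.\<close>
  define C1 where "C1 = fact l * err_const (3 * l)"
  define C2 where "C2 = (\<Sum>i<l. narayana l i * real (Suc i) ^ 2)"
  have "cmod (expect_A l m n B p - of_real (\<Sum>i<l. (real p / real n) ^ i / real (i + 1)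
             * real (l choose i) * real ((l - 1) choose i))) \<le> (C1 + C2) * (1 / real m + 1 / real n)"
    if "n \<ge> 2" "m \<ge> 2" and mub: "mutually_unbiased n m B" and p: "p > 0" "p < n" for n m p B
  proof -
    have mn: "m > 0" "n > 0" using that by auto
    interpret tight_kernel "mub_kernel n B" "{..<m} \<times> {..<n}" m n
      using tight_kernel_mub mub mn by blast
    define \<delta> where "\<delta> = 1 / real m + 1 / real n"
    define q where "q = 1 / real n"
    define c where "c = real n / real p"
    \<comment> \<open>The identity \<open>c * (real p * q) = 1\<close> makes both error bounds
      independent of \<open>p / n\<close>.\<close>
    have q: "q \<ge> 0" "real p * q \<le> 1" "q \<le> \<delta>" and c: "c > 0" "c * (real p * q) = 1" and d: "\<delta> \<ge> 0"
      using p by (auto simp: q_def c_def \<delta>_def)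
    have y: "real p / real n = real p * q" by (simp add: q_def)
    let ?E = "expect_A l m n B p"
    \<comment> \<open>\<open>T\<close> is the expectation with every \<open>norm_sum\<close>
      replaced by its limit.\<close>
    define T where "T = c * (\<Sum>w\<in>words p l. q ^ card (set w) * of_bool (\<not> crossing w))"
    have E: "?E = of_real c * (\<Sum>w\<in>words p l. of_real (q ^ card (set w)) * norm_sum w {})"
      using expect_A_eq[OF mub mn p(1), of "l - 1"] assms by (simp add: c_def q_def)
    have "?E - of_real T = of_real c * (\<Sum>w\<in>words p l. of_real (q ^ card (set w)) * (norm_sum w {} - of_bool (\<not> crossing w)))"
      unfolding E T_def by (simp add: algebra_simps sum_subtractf)
    then have "cmod (?E - of_real T) = c * cmod (\<Sum>w\<in>words p l. of_real (q ^ card (set w)) * (norm_sum w {} - of_bool (\<not> crossing w)))"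
      using c by (simp add: norm_mult)
    also have "\<dots> \<le> c * (\<Sum>w\<in>words p l. q ^ card (set w) * (err_const (3 * l) * \<delta>))"
    proof (intro mult_left_mono sum_norm_le)
      fix w assume w: "w \<in> words p l"
      have "cmod (norm_sum w {} - of_bool (\<not> crossing w)) \<le> err_const (3 * l) * \<delta>"
        unfolding \<delta>_def using w card_length[of w] assms by (intro norm_sum_approx) (auto simp: words_def)
      then have "q ^ card (set w) * cmod (norm_sum w {} - of_bool (\<not> crossing w)) \<le> q ^ card (set w) * (err_const (3 * l) * \<delta>)"
        using q by (intro mult_left_mono) auto
      then show "cmod (of_real (q ^ card (set w)) * (norm_sum w {} - of_bool (\<not> crossing w)))
          \<le> q ^ card (set w) * (err_const (3 * l) * \<delta>)" using q by (simp add: norm_mult norm_power)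
    qed (use c in auto)
    also have "\<dots> = c * (\<Sum>w\<in>words p l. q ^ card (set w)) * (err_const (3 * l) * \<delta>)"
      by (simp only: sum_distrib_right mult.assoc)
    also have "\<dots> \<le> c * (fact l * (real p * q)) * (err_const (3 * l) * \<delta>)"
    proof (intro mult_right_mono mult_left_mono)
      show "(\<Sum>w\<in>words p l. q ^ card (set w)) \<le> fact l * (real p * q)"
        using sum_words_weight_le[OF q(1,2), of "l - 1"] assms by simp
    qed (use c d err_const_pos[of "3 * l"] in auto)
    also have "\<dots> = C1 * \<delta> * (c * (real p * q))" by (simp add: C1_def mult_ac)
    finally have 1: "cmod (?E - of_real T) \<le> C1 * \<delta>" using c(2) by simp
    have T: "T = c * (\<Sum>i<l. q ^ Suc i * ffact p (Suc i) * narayana l i)"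
    proof -
      have "(\<Sum>w\<in>words p l. q ^ card (set w) * of_bool (\<not> crossing w))
          = (\<Sum>w | w \<in> words p l \<and> \<not> crossing w. q ^ card (set w))"
        by (intro sum.mono_neutral_cong_right) auto
      then show ?thesis unfolding T_def using sum_noncrossing_weight[OF assms, of q p] by simp
    qed
    define S where "S = (\<Sum>i<l. (real p / real n) ^ i / real (i + 1) * real (l choose i) * real ((l - 1) choose i))"
    have S: "S = c * (\<Sum>i<l. (real p * q) ^ Suc i * narayana l i)"
    proof -
      have "c * ((real p * q) ^ Suc i * narayana l i) = (c * (real p * q)) * ((real p * q) ^ i * narayana l i)" for i
        by simp
      then show ?thesis unfolding S_def sum_distrib_left y c(2)
        by (intro sum.cong) (auto simp: narayana_def)
    qed
    \<comment> \<open>The two sums have the same Narayana coefficients and differ only in falling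
      factorials against powers of \<open>p\<close>.\<close>
    have "\<bar>T - S\<bar> = c * \<bar>\<Sum>i<l. (q ^ Suc i * ffact p (Suc i) - (real p * q) ^ Suc i) * narayana l i\<bar>"
      unfolding T S using c by (simp add: abs_mult flip: right_diff_distrib sum_subtractf left_diff_distrib del: power_Suc)
    also have "\<dots> \<le> c * (\<Sum>i<l. real (Suc i) ^ 2 * (real p * q) * q * narayana l i)"
    proof (intro mult_left_mono order.trans[OF sum_abs] sum_mono)
      fix i
      have "\<bar>q ^ Suc i * ffact p (Suc i) - (real p * q) ^ Suc i\<bar> \<le> real (Suc i) ^ 2 * (real p * q) * q"
        using ffact_approx[OF q(1,2), of "Suc i"] by (simp only: mult.commute[of "q ^ Suc i"]) linarith
      moreover have "narayana l i \<ge> 0" by (simp add: narayana_def)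
      ultimately show "\<bar>(q ^ Suc i * ffact p (Suc i) - (real p * q) ^ Suc i) * narayana l i\<bar>
          \<le> real (Suc i) ^ 2 * (real p * q) * q * narayana l i"
        unfolding abs_mult by (intro mult_mono) auto
    qed (use c in auto)
    also have "\<dots> = (c * (real p * q)) * (C2 * q)"
      unfolding C2_def sum_distrib_left sum_distrib_right by (intro sum.cong) (auto simp: mult_ac)
    also have "\<dots> \<le> C2 * \<delta>"
    proof -
      have "C2 \<ge> 0" unfolding C2_def by (intro sum_nonneg) (auto simp: narayana_def)
      then show ?thesis using q c by (simp add: mult_left_mono)
    qed
    finally have 2: "\<bar>T - S\<bar> \<le> C2 * \<delta>" .
    have "cmod (?E - of_real S) = cmod ((?E - of_real T) + of_real (T - S))" by simp
    also have "\<dots> \<le> C1 * \<delta> + C2 * \<delta>"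
      using 1 2 by (intro norm_triangle_le add_mono) (auto simp del: of_real_diff)
    finally show ?thesis unfolding S_def \<delta>_def by (simp only: distrib_right)
  qed
  then show ?thesis by blast
qed

end
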